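(* For $q\geq 4$ even, planes in $\mathrm{PG}(5,q)$ with point-orbit distribution $[0,1,0,q^2+q]$ form a unique $K$-orbit, namely $\Sigma_{18},$ with hyperplane-orbit distribution $[1,0,0,q^2+q]$.
   Context: Points of $\mathrm{PG}(5,q)$ are identified with symmetric $3\times3$ matrices over $\mathbb{F}_q$ up to scalars; rank of a point is the rank of its matrix. $K\cong\mathrm{PGL}(3,q)$ acts by $M\mapsto AMA^T$. For $q$ even, the point-orbit distribution of a subspace $W$ is $[r_1,r_{2,n},r_{2,s},r_3]$, where $r_1,r_3$ count points of rank 1 and 3 in $W$, $r_{2,n}$ counts rank-2 points in $W\cap\pi_{\mathcal{N}}$ and $r_{2,s}$ rank-2 points of $W$ outside $\pi_{\mathcal{N}}$; here $\pi_{\mathcal{N}}=\mathcal{Z}(Y_0,Y_3,Y_5)$ is the nucleus plane (zero-diagonal matrices). Hyperplanes $\mathcal{Z}(\sum a_{ij}Y)$ correspond to conics $\mathcal{Z}(\sum_{i\le j}a_{ij}X_iX_j)$ of $\mathrm{PG}(2,q)$, giving four $K$-orbits $\mathcal{H}_1,\mathcal{H}_{2,r},\mathcal{H}_{2,i},\mathcal{H}_3$ (double lines, pairs of real lines, pairs of conjugate imaginary lines, non-singular conics); the hyperplane-orbit distribution of $W$ is $[h_1,h_{2,r},h_{2,i},h_3]$, counting hyperplanes of each orbit containing $W$. $\Sigma_{18}$ is the name given to the resulting orbit. *)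

theory Defs
  imports "HOL-Analysis.Analysis" "HOL-Algebra.Algebraic_Closure_Type"
begin

text \<open>
  The field with \<open>q\<close> elements is a type \<open>'a :: {field, finite}\<close> with \<open>q = CARD('a)\<close>.
  The index type \<open>3\<close> has the elements \<open>0 < 1 < 2\<close>, matching the coordinates \<open>X\<^sub>0, X\<^sub>1, X\<^sub>2\<close>;
  the coordinates \<open>Y\<^sub>0, \<dots>, Y\<^sub>5\<close> of a symmetric matrix are its entries
  \<open>(0,0), (0,1), (0,2), (1,1), (1,2), (2,2)\<close>.
\<close>

definition mat_scale :: "'a::field \<Rightarrow> 'a^'n^'m \<Rightarrow> 'a^'n^'m" where
  "mat_scale c M = (\<chi> i j. c * M $ i $ j)"

global_interpretation mats: vector_space "mat_scale :: 'a::field \<Rightarrow> 'a^'n^'m \<Rightarrow> 'a^'n^'m"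
  by unfold_locales (simp_all add: mat_scale_def vec_eq_iff algebra_simps)

definition sym_mats :: "('a::field^3^3) set" where
  "sym_mats = {M. transpose M = M}"

definition pg5_subspaces :: "nat \<Rightarrow> ('a::field^3^3) set set" where
  \<comment> \<open>\<open>d\<close> is the projective dimension\<close>
  "pg5_subspaces d = {U. mats.subspace U \<and> U \<subseteq> sym_mats \<and> mats.dim U = d + 1}"

definition nucleus_plane :: "('a::field^3^3) set" where
  "nucleus_plane = {M \<in> sym_mats. \<forall>i. M $ i $ i = 0}"


subsection \<open>The group \<open>K\<close> and its orbits\<close>

definition K_map :: "'a::field^3^3 \<Rightarrow> ('a^3^3) set \<Rightarrow> ('a^3^3) set" where
  "K_map A U = (\<lambda>M. A ** M ** transpose A) ` U"

definition K_group :: "(('a::field^3^3) set \<Rightarrow> ('a^3^3) set) set" where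
  "K_group = K_map ` {A. invertible A}"

definition K_orbit :: "('a::field^3^3) set \<Rightarrow> ('a^3^3) set set" where
  "K_orbit U = {g U | g. g \<in> K_group}"

definition plane_orbits :: "('a::field^3^3) set set set" where
  "plane_orbits = K_orbit ` pg5_subspaces 2"


subsection \<open>Point-orbit distribution\<close>

definition rank_points :: "nat \<Rightarrow> ('a::field^3^3) set set" where
  "rank_points r = {P \<in> pg5_subspaces 0. \<forall>M \<in> P - {0}. rank M = r}"

definition point_orbit_distribution :: "('a::field^3^3) set \<Rightarrow> nat \<times> nat \<times> nat \<times> nat" where
  "point_orbit_distribution W =
    (card {P \<in> rank_points 1. P \<subseteq> W},
     card {P \<in> rank_points 2. P \<subseteq> W \<inter> nucleus_plane},
     card {P \<in> rank_points 2. P \<subseteq> W \<and> \<not> P \<subseteq> nucleus_plane},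
     card {P \<in> rank_points 3. P \<subseteq> W})"


subsection \<open>Conics of \<open>PG(2,q)\<close>\<close>

text \<open>
  The ternary quadratic form \<open>\<Sum>\<^sub>i\<^sub>\<le>\<^sub>j a\<^sub>i\<^sub>j X\<^sub>i X\<^sub>j\<close> is given by the upper triangular matrix of its
  coefficients, a linear form by its coefficient vector.
\<close>

definition quadratic_forms :: "('a::field^3^3) set" where
  "quadratic_forms = {a. a \<noteq> 0 \<and> (\<forall>i j. j < i \<longrightarrow> a $ i $ j = 0)}"

definition qf_eval :: "'a::field^3^3 \<Rightarrow> 'a^3 \<Rightarrow> 'a" where
  "qf_eval a x = (\<Sum>i\<in>UNIV. \<Sum>j\<in>{i..}. a $ i $ j * x $ i * x $ j)"

definition qf_partial :: "'a::field^3^3 \<Rightarrow> 3 \<Rightarrow> 'a^3 \<Rightarrow> 'a" where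
  \<comment> \<open>the formal partial derivative with respect to \<open>X\<^sub>k\<close>\<close>
  "qf_partial a k x = (\<Sum>i\<in>UNIV. \<Sum>j\<in>{i..}. a $ i $ j *
     ((if i = k then x $ j else 0) + (if j = k then x $ i else 0)))"

definition line_product :: "'a::field^3 \<Rightarrow> 'a^3 \<Rightarrow> 'a^3^3" where
  \<comment> \<open>coefficients of \<open>(\<Sum>\<^sub>i l\<^sub>i X\<^sub>i) (\<Sum>\<^sub>j m\<^sub>j X\<^sub>j)\<close>\<close>
  "line_product l m = (\<chi> i j. if i = j then l $ i * m $ i
     else if i < j then l $ i * m $ j + l $ j * m $ i else 0)"

definition distinct_lines :: "'a::field^3 \<Rightarrow> 'a^3 \<Rightarrow> bool" where
  "distinct_lines l m \<longleftrightarrow> l \<noteq> 0 \<and> m \<noteq> 0 \<and> (\<forall>k. m \<noteq> k *s l)"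

definition ac_mat :: "'a::field^3^3 \<Rightarrow> 'a alg_closure^3^3" where
  "ac_mat a = (\<chi> i j. to_ac (a $ i $ j))"

definition conj_line :: "'a::{field,finite} alg_closure^3 \<Rightarrow> 'a alg_closure^3" where
  "conj_line l = (\<chi> i. (l $ i) ^ CARD('a))"

definition double_line :: "'a::field^3^3 \<Rightarrow> bool" where
  "double_line a \<longleftrightarrow> (\<exists>c l. c \<noteq> 0 \<and> l \<noteq> 0 \<and> a = mat_scale c (line_product l l))"

definition real_line_pair :: "'a::field^3^3 \<Rightarrow> bool" where
  "real_line_pair a \<longleftrightarrow>
     (\<exists>c l m. c \<noteq> 0 \<and> distinct_lines l m \<and> a = mat_scale c (line_product l m))"

definition imaginary_line_pair :: "'a::{field,finite}^3^3 \<Rightarrow> bool" where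
  \<comment> \<open>the field with \<open>q\<^sup>2\<close> elements is the set of roots of \<open>X ^ (q\<^sup>2) - X\<close> in the algebraic closure\<close>
  "imaginary_line_pair a \<longleftrightarrow>
     (\<exists>c l. c \<noteq> 0 \<and> (\<forall>i. (l $ i) ^ (CARD('a)\<^sup>2) = l $ i) \<and> distinct_lines l (conj_line l) \<and>
        ac_mat a = mat_scale (to_ac c) (line_product l (conj_line l)))"

definition nonsingular_conic :: "'a::field^3^3 \<Rightarrow> bool" where
  \<comment> \<open>no singular points over the algebraic closure; in characteristic 2 the vanishing of the
    partial derivatives does not imply that of the form, so both are required\<close>
  "nonsingular_conic a \<longleftrightarrow>
     \<not> (\<exists>x. x \<noteq> 0 \<and> qf_eval (ac_mat a) x = 0 \<and> (\<forall>k. qf_partial (ac_mat a) k x = 0))"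


subsection \<open>Hyperplane-orbit distribution\<close>

definition hyperplane_of :: "'a::field^3^3 \<Rightarrow> ('a^3^3) set" where
  "hyperplane_of a = {M \<in> sym_mats. (\<Sum>i\<in>UNIV. \<Sum>j\<in>{i..}. a $ i $ j * M $ i $ j) = 0}"

definition hyperplanes_of_type :: "('a::field^3^3 \<Rightarrow> bool) \<Rightarrow> ('a^3^3) set set" where
  "hyperplanes_of_type T = hyperplane_of ` {a \<in> quadratic_forms. T a}"

definition hyperplane_orbit_distribution ::
    "('a::{field,finite}^3^3) set \<Rightarrow> nat \<times> nat \<times> nat \<times> nat" where
  "hyperplane_orbit_distribution W =
    (card {H \<in> hyperplanes_of_type double_line. W \<subseteq> H},
     card {H \<in> hyperplanes_of_type real_line_pair. W \<subseteq> H},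
     card {H \<in> hyperplanes_of_type imaginary_line_pair. W \<subseteq> H},
     card {H \<in> hyperplanes_of_type nonsingular_conic. W \<subseteq> H})"

end

theory Submission
  imports Defs
begin

text \<open>
  In characteristic 2 a symmetric matrix with diagonal \<open>x\<close> and off-diagonal entries
  \<open>n = (N\<^sub>1\<^sub>2, N\<^sub>0\<^sub>2, N\<^sub>0\<^sub>1)\<close> has determinant \<open>x\<^sub>0 x\<^sub>1 x\<^sub>2 + \<Sum> x\<^sub>i n\<^sub>i\<^sup>2\<close>. Let \<open>M = (0, u)\<close> be the only
  singular point of the plane \<open>W\<close>. As \<open>det (N + t M) = det N + t\<^sup>2 \<Sum> x\<^sub>i u\<^sub>i\<^sup>2\<close> and every scalar is a
  square, the diagonals of \<open>W\<close> are exactly the \<open>x\<close> with \<open>\<Sum> x\<^sub>i u\<^sub>i\<^sup>2 = 0\<close>. Moving \<open>u\<close> to the last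
  basis vector brings \<open>W\<close> into a normal form given by a 2 by 2 matrix \<open>L\<close>, on which the determinant
  is the square of the binary cubic \<open>det (v, L v\<^sup>(\<^sup>2\<^sup>))\<close>, where \<open>v\<^sup>(\<^sup>2\<^sup>)\<close> consists of the squares of the
  entries of \<open>v\<close>. So \<open>W\<close> corresponds to a cubic without rational zeros. Any two such cubics are
  equivalent: their roots lie in the field with \<open>q\<^sup>3\<close> elements, where any two irrational elements are
  related by a fractional linear map over the field with \<open>q\<close> elements.

  A conic containing \<open>W\<close> is a double line if its nucleus \<open>p\<close> vanishes, which happens for one conic
  only. Otherwise \<open>W\<close> contains a matrix with diagonal \<open>p\<^sup>2\<close>, whose determinant is the square of the
  value of the conic at \<open>p\<close>, so that the conic is non-singular.
\<close>

subsection \<open>Finite fields of characteristic two\<close>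

text \<open>Rewrite rules that, combined with \<open>algebra_simps\<close>, cancel equal summands
  and remove signs, so that \<open>simp\<close> proves polynomial identities in characteristic
  2.\<close>

lemma char2_simps:
  fixes x y :: "'b::comm_ring_1"
  assumes "(2::'b) = 0"
  shows "x + x = 0" "x + (x + y) = y" "- x = x" "x - y = x + y"
proof -
  show 1: "x + x = 0"
    using assms by (metis mult_2 mult_zero_left)
  show "x + (x + y) = y"
    using 1 by (simp flip: add.assoc)
  show "- x = x"
    using 1 by (simp add: minus_unique)
  have "- y = y"
    using assms by (metis minus_unique mult_2 mult_zero_left)
  then show "x - y = x + y"
    by (metis diff_conv_add_uminus)
qed

text \<open>Multiplication by a nonzero \<open>x\<close> permutes the nonzero elements; comparing
  the products of all of them, with one extra factor \<open>x\<close>, gives the claim.\<close>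

lemma finite_field_power_card:
  fixes x :: "'a::{field,finite}"
  shows "x ^ CARD('a) = x"
proof (cases "x = 0")
  case False
  have "x * (\<Prod>y\<in>UNIV-{0}. x * y) = x * x ^ (CARD('a) - 1) * \<Prod>(UNIV-{0})"
    by (simp add: prod.distrib mult_ac)
  also have "x * x ^ (CARD('a) - 1) = x ^ CARD('a)"
    by (metis One_nat_def Suc_pred power_Suc zero_less_card_finite)
  also have "(\<Prod>y\<in>UNIV-{0}. x * y) = (\<Prod>y\<in>UNIV-{0}. y)"
    by (rule prod.reindex_bij_witness[of _ "\<lambda>y. y / x" "\<lambda>y. x * y"]) (use False in auto)
  finally show ?thesis
    by simp
qed simp

text \<open>For even q, -1 = (-1)^q = 1.\<close>

lemma even_card_imp_char2:
  assumes "even CARD('a::{field,finite})"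
  shows "(2::'a) = 0"
proof -
  have "(- 1 :: 'a) = (- 1) ^ CARD('a)"
    by (simp only: finite_field_power_card)
  also have "\<dots> = 1"
    using assms by simp
  finally have "(1::'a) + 1 = 0"
    by (metis add.right_inverse)
  then show ?thesis
    by simp
qed

text \<open>Squaring is additive in characteristic 2, hence injective, and on a finite field
  surjective.\<close>

lemma ex_square_root_char2:
  fixes x :: "'a::{field,finite}"
  assumes "(2::'a) = 0"
  shows "\<exists>y. x = y^2"
proof -
  have "inj (\<lambda>y::'a. y^2)"
  proof (rule injI)
    fix y z :: 'a assume "y^2 = z^2"
    then have "(y + z)^2 = 0"
      by (simp add: power2_eq_square algebra_simps char2_simps[OF assms])
    then show "y = z"
      using char2_simps(3)[OF assms, of z] by (simp add: add_eq_0_iff2)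
  qed
  then have "surj (\<lambda>y::'a. y^2)"
    by (simp add: finite_UNIV_inj_surj)
  then show ?thesis
    by blast
qed

section \<open>The q-power Frobenius map on the algebraic closure\<close>

text \<open>(X + 1)^q and X^q + 1 agree at all q elements of the field and in their coefficient of
  degree q, so they are the same polynomial. The middle binomial coefficients therefore vanish,
  without appeal to q being a prime power.\<close>

lemma frobenius_add:
  fixes x y :: "'a::{field,finite} alg_closure"
  shows "(x + y) ^ CARD('a) = x ^ CARD('a) + y ^ CARD('a)"
proof -
  let ?q = "CARD('a)"
  have "[:1, 1:] ^ ?q = Polynomial.monom (1::'a) ?q + 1"
  proof (rule poly_eqI_degree_lead_coeff[where n = ?q and A = UNIV])
    show "Polynomial.coeff ([:1, 1:] ^ ?q) ?q = Polynomial.coeff (Polynomial.monom (1::'a) ?q + 1) ?q"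
      by (simp add: coeff_linear_poly_power)
    show "Polynomial.degree ([:1, 1::'a:] ^ ?q) \<le> ?q"
      by (simp add: degree_linear_power)
    show "Polynomial.degree (Polynomial.monom (1::'a) ?q + 1) \<le> ?q"
      by (rule degree_add_le) (simp_all add: degree_monom_le)
    show "poly ([:1, 1:] ^ ?q) z = poly (Polynomial.monom 1 ?q + 1) z" for z :: 'a
      by (simp add: poly_monom finite_field_power_card add.commute)
  qed simp
  then have "Polynomial.coeff ([:1, 1:] ^ ?q) k = Polynomial.coeff (Polynomial.monom (1::'a) ?q + 1) k" for k
    by (rule arg_cong)
  then have "of_nat (?q choose k) = (0::'a)" if "0 < k" "k < ?q" for k
    using that coeff_linear_poly_power[of k ?q 1 "1::'a"] by simp
  then have mid: "of_nat (?q choose k) = (0::'a alg_closure)" if "0 < k" "k < ?q" for k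
    using that by (metis to_ac_0 to_ac_of_nat)
  have "(x + y) ^ ?q = (\<Sum>k\<le>?q. of_nat (?q choose k) * x ^ k * y ^ (?q - k))"
    by (rule binomial_ring)
  also have "\<dots> = (\<Sum>k\<in>{0, ?q}. of_nat (?q choose k) * x ^ k * y ^ (?q - k))"
    by (rule sum.mono_neutral_right) (auto simp: mid)
  finally show ?thesis
    by (simp add: add.commute)
qed

lemma card_power_eq_self_le:
  fixes n :: nat
  assumes "n > 1"
  shows "finite {x::'b::field. x ^ n = x}" "card {x::'b::field. x ^ n = x} \<le> n"
proof -
  let ?p = "Polynomial.monom (1::'b) n - Polynomial.monom 1 1"
  have "Polynomial.coeff ?p n = 1"
    using assms by simp
  then have "?p \<noteq> 0"
    by (metis coeff_0 zero_neq_one)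
  moreover have "Polynomial.degree ?p \<le> n"
    using assms by (intro degree_diff_le) (auto intro: order.trans[OF degree_monom_le])
  moreover have "{x. poly ?p x = 0} = {x. x ^ n = x}"
    by (auto simp: poly_monom)
  ultimately show "finite {x::'b. x ^ n = x}" "card {x::'b. x ^ n = x} \<le> n"
    using poly_roots_finite[of ?p] card_poly_roots_bound[of ?p] by simp_all
qed

lemma card_field_gt_1: "CARD('a::{field,finite}) > 1"
  using card_mono[of UNIV "{0, 1::'a}"] by simp

text \<open>The equation x^q = x has at most q roots, and the elements of the base field already
  supply q of them.\<close>

lemma frobenius_fixed_imp_range:
  fixes x :: "'a::{field,finite} alg_closure"
  assumes "x ^ CARD('a) = x"
  shows "\<exists>t. x = to_ac t"
proof -
  have "range to_ac \<subseteq> {x::'a alg_closure. x ^ CARD('a) = x}"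
    by (auto simp: finite_field_power_card simp flip: to_ac_power)
  moreover have "card (range (to_ac :: 'a \<Rightarrow> _)) = CARD('a)"
    by (rule card_image) (rule inj_to_ac)
  ultimately have "range to_ac = {x::'a alg_closure. x ^ CARD('a) = x}"
    using card_power_eq_self_le[OF card_field_gt_1, where ?'a1 = 'a and ?'b = "'a alg_closure"]
    by (intro card_seteq) auto
  then show ?thesis
    using assms by auto
qed

subsection \<open>Anisotropic binary cubic forms\<close>

definition binary_cubic :: "'b::comm_ring_1 \<Rightarrow> 'b \<Rightarrow> 'b \<Rightarrow> 'b \<Rightarrow> 'b \<Rightarrow> 'b \<Rightarrow> 'b" where
  "binary_cubic c\<^sub>3 c\<^sub>2 c\<^sub>1 c\<^sub>0 x y = c\<^sub>3 * x^3 + c\<^sub>2 * x^2 * y + c\<^sub>1 * x * y^2 + c\<^sub>0 * y^3"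

definition anisotropic :: "'b::comm_ring_1 \<Rightarrow> 'b \<Rightarrow> 'b \<Rightarrow> 'b \<Rightarrow> bool" where
  "anisotropic c\<^sub>3 c\<^sub>2 c\<^sub>1 c\<^sub>0 \<longleftrightarrow> (\<forall>x y. binary_cubic c\<^sub>3 c\<^sub>2 c\<^sub>1 c\<^sub>0 x y = 0 \<longrightarrow> x = 0 \<and> y = 0)"

lemma anisotropic_lead_nonzero: "anisotropic c\<^sub>3 c\<^sub>2 c\<^sub>1 c\<^sub>0 \<Longrightarrow> c\<^sub>3 \<noteq> 0"
  unfolding anisotropic_def binary_cubic_def by (erule allE[of _ 1], erule allE[of _ 0]) simp

text \<open>The binary form dehomogenised at \<open>y = 1\<close>. Anisotropy makes the leading
  coefficient nonzero, so this is a genuine cubic equation.\<close>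

abbreviation ac_root :: "'a::field \<Rightarrow> 'a \<Rightarrow> 'a \<Rightarrow> 'a \<Rightarrow> 'a alg_closure \<Rightarrow> bool" where
  "ac_root c\<^sub>3 c\<^sub>2 c\<^sub>1 c\<^sub>0 \<theta> \<equiv> to_ac c\<^sub>3 * \<theta>^3 + to_ac c\<^sub>2 * \<theta>^2 + to_ac c\<^sub>1 * \<theta> + to_ac c\<^sub>0 = 0"

lemma ex_ac_root:
  assumes "c\<^sub>3 \<noteq> 0"
  shows "\<exists>\<theta>. ac_root c\<^sub>3 c\<^sub>2 c\<^sub>1 c\<^sub>0 \<theta>"
proof -
  let ?p = "[:to_ac c\<^sub>0, to_ac c\<^sub>1, to_ac c\<^sub>2, to_ac c\<^sub>3:]"
  have "Polynomial.degree ?p > 0"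
    using assms by simp
  then obtain \<theta> where "poly ?p \<theta> = 0"
    using alg_closed_imp_poly_has_root by blast
  then have "ac_root c\<^sub>3 c\<^sub>2 c\<^sub>1 c\<^sub>0 \<theta>"
    by (simp add: algebra_simps power2_eq_square power3_eq_cube)
  then show ?thesis ..
qed

lemma anisotropic_root_irrational:
  assumes "anisotropic c\<^sub>3 c\<^sub>2 c\<^sub>1 c\<^sub>0" "ac_root c\<^sub>3 c\<^sub>2 c\<^sub>1 c\<^sub>0 \<theta>"
  shows "\<theta> \<noteq> to_ac t"
proof
  assume "\<theta> = to_ac t"
  then have "to_ac (binary_cubic c\<^sub>3 c\<^sub>2 c\<^sub>1 c\<^sub>0 t 1) = 0"
    using assms(2) by (simp add: binary_cubic_def)
  then show False
    using assms(1) unfolding anisotropic_def by (metis to_ac_eq_0_iff zero_neq_one)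
qed

lemma anisotropic_root_linear:
  assumes "anisotropic c\<^sub>3 c\<^sub>2 c\<^sub>1 c\<^sub>0" "ac_root c\<^sub>3 c\<^sub>2 c\<^sub>1 c\<^sub>0 \<theta>"
    and "to_ac b * \<theta> + to_ac c = 0"
  shows "b = 0 \<and> c = 0"
proof (cases "b = 0")
  case False
  then have "\<theta> = to_ac (- c / b)"
    using assms(3) by (simp add: field_simps eq_neg_iff_add_eq_0)
  then show ?thesis
    using anisotropic_root_irrational[OF assms(1,2)] by blast
qed (use assms(3) in simp)

text \<open>A cubic without rational zeros is irreducible, so \<open>\<theta>\<close> has degree 3
  over the base field: a quadratic equation for \<open>\<theta>\<close> would divide the cubic and
  leave a linear factor with a rational zero.\<close>

lemma anisotropic_root_quadratic:
  assumes an: "anisotropic c\<^sub>3 c\<^sub>2 c\<^sub>1 c\<^sub>0" and rt: "ac_root c\<^sub>3 c\<^sub>2 c\<^sub>1 c\<^sub>0 \<theta>"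
    and quad: "to_ac a * \<theta>^2 + to_ac b * \<theta> + to_ac c = 0"
  shows "a = 0 \<and> b = 0 \<and> c = 0"
proof (cases "a = 0")
  case True
  then show ?thesis
    using quad anisotropic_root_linear[OF an rt, of b c] by simp
next
  case False
  define b' c' where "b' = b / a" and "c' = c / a"
  \<comment> \<open>Division of the cubic by X^2 + b' X + c' has the quotient
    \<open>c\<^sub>3 X + e\<close>. The linear remainder vanishes at \<open>\<theta>\<close>, hence
    identically.\<close>
  define e where "e = c\<^sub>2 - c\<^sub>3 * b'"
  have "to_ac a * (\<theta>^2 + to_ac b' * \<theta> + to_ac c') = 0"
    using quad False by (simp add: b'_def c'_def algebra_simps)
  then have m: "\<theta>^2 + to_ac b' * \<theta> + to_ac c' = 0"
    using False by simp
  have "to_ac (c\<^sub>1 - c\<^sub>3 * c' - e * b') * \<theta> + to_ac (c\<^sub>0 - e * c')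
      = (to_ac c\<^sub>3 * \<theta>^3 + to_ac c\<^sub>2 * \<theta>^2 + to_ac c\<^sub>1 * \<theta> + to_ac c\<^sub>0)
        - (to_ac c\<^sub>3 * \<theta> + to_ac e) * (\<theta>^2 + to_ac b' * \<theta> + to_ac c')"
    by (simp add: e_def algebra_simps power2_eq_square power3_eq_cube)
  also have "\<dots> = 0"
    by (simp only: rt m) simp
  finally have "c\<^sub>1 - c\<^sub>3 * c' - e * b' = 0 \<and> c\<^sub>0 - e * c' = 0"
    by (rule anisotropic_root_linear[OF an rt])
  then have c: "c\<^sub>1 = c\<^sub>3 * c' + e * b'" "c\<^sub>0 = e * c'" "c\<^sub>2 = e + c\<^sub>3 * b'"
    by (auto simp: e_def algebra_simps)
  have "binary_cubic c\<^sub>3 c\<^sub>2 c\<^sub>1 c\<^sub>0 x 1 = (x^2 + b' * x + c') * (c\<^sub>3 * x + e)" for x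
    unfolding binary_cubic_def c by (simp add: algebra_simps power2_eq_square power3_eq_cube)
  moreover have "c\<^sub>3 * (- e / c\<^sub>3) + e = 0"
    using anisotropic_lead_nonzero[OF an] by simp
  ultimately have "binary_cubic c\<^sub>3 c\<^sub>2 c\<^sub>1 c\<^sub>0 (- e / c\<^sub>3) 1 = 0"
    by simp
  then show ?thesis
    using an unfolding anisotropic_def by (metis zero_neq_one)
qed

text \<open>Frobenius permutes the at most three roots, so among the q^i-th powers of
  \<open>\<theta>\<close> for i = 0, ..., 3 two coincide. Injectivity of Frobenius turns this into a
  period of 1, 2 or 3; the periods 1 and 2 contradict irreducibility.\<close>

lemma anisotropic_root_in_cubic_extension:
  fixes \<theta> :: "'a::{field,finite} alg_closure"
  assumes two: "(2::'a) = 0"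
    and an: "anisotropic c\<^sub>3 c\<^sub>2 c\<^sub>1 c\<^sub>0" and rt: "ac_root c\<^sub>3 c\<^sub>2 c\<^sub>1 c\<^sub>0 \<theta>"
  shows "\<theta> ^ (CARD('a) ^ 3) = \<theta>"
proof -
  let ?q = "CARD('a)"
  have two': "(2::'a alg_closure) = 0"
    using two by (metis to_ac_0 to_ac_numeral)
  have fr_ac: "to_ac c ^ ?q = to_ac c" for c :: 'a
    by (simp add: finite_field_power_card flip: to_ac_power)
  have fr_root: "ac_root c\<^sub>3 c\<^sub>2 c\<^sub>1 c\<^sub>0 (x ^ ?q)" if "ac_root c\<^sub>3 c\<^sub>2 c\<^sub>1 c\<^sub>0 x" for x
  proof -
    have "(to_ac c\<^sub>3 * x^3 + to_ac c\<^sub>2 * x^2 + to_ac c\<^sub>1 * x + to_ac c\<^sub>0) ^ ?q = 0"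
      unfolding that by simp
    then show ?thesis
      by (simp add: frobenius_add power_mult_distrib fr_ac mult.commute flip: power_mult)
  qed
  have fr_iter: "ac_root c\<^sub>3 c\<^sub>2 c\<^sub>1 c\<^sub>0 (\<theta> ^ (?q ^ i))" for i
  proof (induction i)
    case (Suc i)
    then show ?case
      using fr_root[of "\<theta> ^ (?q ^ i)"] by (simp only: power_Suc2 power_mult)
  qed (use rt in simp)
  have fr_inj: "x = y" if "x ^ ?q = y ^ ?q" for x y :: "'a alg_closure"
  proof -
    have "(x + y) ^ ?q = 0"
      using that by (simp add: frobenius_add char2_simps[OF two'])
    then show ?thesis
      using char2_simps(3)[OF two', of y] by (simp add: add_eq_0_iff2)
  qed
  have fr_cancel: "x = y" if "x ^ (?q ^ i) = y ^ (?q ^ i)" for x y :: "'a alg_closure" and i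
    using that by (induction i) (auto simp: power_mult mult.commute[of ?q] dest: fr_inj)
  let ?p = "[:to_ac c\<^sub>0, to_ac c\<^sub>1, to_ac c\<^sub>2, to_ac c\<^sub>3:]"
  have p0: "?p \<noteq> 0"
    using anisotropic_lead_nonzero[OF an] by simp
  have roots: "{x. poly ?p x = 0} = {x. ac_root c\<^sub>3 c\<^sub>2 c\<^sub>1 c\<^sub>0 x}"
    by (simp add: algebra_simps power2_eq_square power3_eq_cube)
  have fin: "finite {x. ac_root c\<^sub>3 c\<^sub>2 c\<^sub>1 c\<^sub>0 x}"
    using poly_roots_finite[OF p0] by (simp only: roots)
  have "card {x. ac_root c\<^sub>3 c\<^sub>2 c\<^sub>1 c\<^sub>0 x} \<le> Polynomial.degree ?p"
    using card_poly_roots_bound[OF p0] by (simp only: roots)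
  also have "\<dots> \<le> 3"
    by simp
  finally have "card {x. ac_root c\<^sub>3 c\<^sub>2 c\<^sub>1 c\<^sub>0 x} < card {..3::nat}"
    by simp
  moreover have "(\<lambda>i. \<theta> ^ (?q ^ i)) ` {..3::nat} \<subseteq> {x. ac_root c\<^sub>3 c\<^sub>2 c\<^sub>1 c\<^sub>0 x}"
    using fr_iter by blast
  ultimately have "\<not> inj_on (\<lambda>i. \<theta> ^ (?q ^ i)) {..3::nat}"
    using card_inj_on_le[OF _ _ fin] by fastforce
  then obtain i j where ij: "i < j" "j \<le> 3" "\<theta> ^ (?q ^ i) = \<theta> ^ (?q ^ j)"
    unfolding inj_on_def by (metis atMost_iff linorder_neqE_nat)
  have "(\<theta> ^ (?q ^ (j - i))) ^ (?q ^ i) = \<theta> ^ (?q ^ i)"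
    using ij by (simp flip: power_mult power_add)
  then have k: "\<theta> ^ (?q ^ (j - i)) = \<theta>"
    by (rule fr_cancel)
  consider "j - i = 1" | "j - i = 2" | "j - i = 3"
    using ij by linarith
  then show ?thesis
  proof cases
    case 1
    then obtain t where "\<theta> = to_ac t"
      using k frobenius_fixed_imp_range by auto
    then show ?thesis
      using anisotropic_root_irrational[OF an rt] by blast
  next
    case 2
    then have qq: "(\<theta> ^ ?q) ^ ?q = \<theta>"
      using k by (simp add: power2_eq_square power_mult)
    \<comment> \<open>With period 2, trace and norm of \<open>\<theta>\<close> are fixed by
      Frobenius and hence rational, so \<open>\<theta>\<close> would satisfy a rational quadratic
      equation.\<close>
    have "(\<theta> + \<theta> ^ ?q) ^ ?q = \<theta> + \<theta> ^ ?q"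
      by (simp only: frobenius_add qq) (simp add: add.commute)
    then obtain s where s: "\<theta> + \<theta> ^ ?q = to_ac s"
      using frobenius_fixed_imp_range by blast
    have "(\<theta> * \<theta> ^ ?q) ^ ?q = \<theta> * \<theta> ^ ?q"
      by (simp only: power_mult_distrib qq) (simp add: mult.commute)
    then obtain n where n: "\<theta> * \<theta> ^ ?q = to_ac n"
      using frobenius_fixed_imp_range by blast
    have "to_ac 1 * \<theta>^2 + to_ac (- s) * \<theta> + to_ac n = 0"
      unfolding to_ac_minus s[symmetric] n[symmetric] by (simp add: algebra_simps power2_eq_square)
    then show ?thesis
      using anisotropic_root_quadratic[OF an rt] zero_neq_one by metis
  next
    case 3
    then show ?thesis
      using k by simp
  qed
qed


text \<open>The elements 1, \<theta>, \<eta>, \<theta>\<eta> have q^4 combinations over the base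
  field, all inside a set of at most q^3 elements. The resulting nontrivial linear relation, solved
  for \<eta>, is a fractional linear map.\<close>

lemma roots_projectively_equivalent:
  fixes \<theta> \<eta> :: "'a::{field,finite} alg_closure"
  assumes \<theta>: "\<theta> ^ (CARD('a) ^ 3) = \<theta>" and \<eta>: "\<eta> ^ (CARD('a) ^ 3) = \<eta>"
    and irr: "\<And>b c. to_ac b * \<theta> + to_ac c = 0 \<Longrightarrow> b = 0 \<and> c = 0" "\<And>t. \<eta> \<noteq> to_ac t"
  shows "\<exists>a b c d. a * d - b * c \<noteq> 0 \<and> \<eta> * (to_ac c * \<theta> + to_ac d) = to_ac a * \<theta> + to_ac b"
proof -
  let ?q = "CARD('a)"
  define K where "K = {x :: 'a alg_closure. x ^ (?q ^ 3) = x}"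
  have fr_add: "(x + y) ^ (?q ^ n) = x ^ (?q ^ n) + y ^ (?q ^ n)" for x y :: "'a alg_closure" and n
    by (induction n) (simp_all only: power_Suc2 power_mult frobenius_add power_0 power_one_right)
  have fr_ac: "to_ac c ^ (?q ^ n) = to_ac c" for c :: 'a and n
    by (induction n) (simp_all add: power_mult finite_field_power_card flip: to_ac_power)
  define f where "f = (\<lambda>(a, b, c, d). (to_ac a * \<theta> + to_ac b) + (to_ac (- c) * \<theta> + to_ac (- d)) * \<eta>)"
  have f_add: "f (a, b, c, d) - f (a', b', c', d') = f (a - a', b - b', c - c', d - d')"
    for a b c d a' b' c' d'
    by (simp add: f_def algebra_simps)
  have "range f \<subseteq> K"
    using \<theta> \<eta> by (auto simp: f_def K_def fr_add fr_ac power_mult_distrib simp del: to_ac_minus)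
  moreover have "?q ^ 3 > 1"
    using card_field_gt_1[where 'a = 'a] by (intro one_less_power) auto
  then have "finite K" "card K \<le> ?q ^ 3"
    unfolding K_def by (rule card_power_eq_self_le)+
  moreover have "?q ^ 3 < card (UNIV :: ('a \<times> 'a \<times> 'a \<times> 'a) set)"
    using card_field_gt_1[where 'a = 'a]
    by (simp add: power3_eq_cube flip: UNIV_Times_UNIV)
  ultimately have "\<not> inj f"
    using card_inj_on_le[of f UNIV K] by linarith
  then obtain v w where vw: "v \<noteq> w" "f v - f w = 0"
    by (metis diff_self injI)
  obtain a b c d a' b' c' d' where "v = (a, b, c, d)" "w = (a', b', c', d')"
    by (metis prod_cases4)
  then have "f (a - a', b - b', c - c', d - d') = 0" "(a - a', b - b', c - c', d - d') \<noteq> (0, 0, 0, 0)"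
    using vw by (auto simp flip: f_add)
  then obtain a b c d where z: "f (a, b, c, d) = 0" "(a, b, c, d) \<noteq> (0, 0, 0, 0)"
    by blast
  have eq: "\<eta> * (to_ac c * \<theta> + to_ac d) = to_ac a * \<theta> + to_ac b"
    using z(1) by (simp add: f_def algebra_simps)
  have "a * d - b * c \<noteq> 0"
  proof
    assume 0: "a * d - b * c = 0"
    have cd: "c \<noteq> 0 \<or> d \<noteq> 0"
      using eq irr(1)[of a b] z(2) by auto
    then have nz: "to_ac c * \<theta> + to_ac d \<noteq> 0"
      using irr(1) by blast
    \<comment> \<open>A vanishing determinant makes \<open>(a, b)\<close> a multiple
      \<open>t\<close> of \<open>(c, d)\<close>, and then \<eta> would be the rational element
      \<open>t\<close>.\<close>
    obtain t where "a = t * c" "b = t * d"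
    proof (cases "c = 0")
      case True
      then show ?thesis
        using 0 cd by (intro that[of "b / d"]) auto
    next
      case False
      then show ?thesis
        using 0 by (intro that[of "a / c"]) (auto simp: field_simps)
    qed
    then have "(\<eta> - to_ac t) * (to_ac c * \<theta> + to_ac d) = 0"
      using eq by (simp add: algebra_simps)
    then show False
      using nz irr(2) by simp
  qed
  then show ?thesis
    using eq by blast
qed

text \<open>
  The cubic form with coefficients \<open>\<gamma>, \<alpha>, \<delta>, \<beta>\<close> is \<open>det (v, L v\<^sup>(\<^sup>2\<^sup>))\<close>, where \<open>L\<close> has the rows
  \<open>(\<alpha>, \<beta>)\<close>, \<open>(\<gamma>, \<delta>)\<close>. The four equations say \<open>s B L = L' B\<^sup>(\<^sup>2\<^sup>)\<close>; \<open>B\<close> moves a root of the first cubic to a root of the second.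
\<close>

lemma anisotropic_cubics_equivalent:
  fixes \<alpha> \<beta> \<gamma> \<delta> \<alpha>' \<beta>' \<gamma>' \<delta>' :: "'a::{field,finite}"
  assumes two: "(2::'a) = 0"
    and an: "anisotropic \<gamma> \<alpha> \<delta> \<beta>" and an': "anisotropic \<gamma>' \<alpha>' \<delta>' \<beta>'"
  shows "\<exists>a b c d s. s \<noteq> 0 \<and> a * d - b * c \<noteq> 0 \<and>
    s * (a * \<alpha> + b * \<gamma>) = \<alpha>' * a^2 + \<beta>' * c^2 \<and> s * (a * \<beta> + b * \<delta>) = \<alpha>' * b^2 + \<beta>' * d^2 \<and>
    s * (c * \<alpha> + d * \<gamma>) = \<gamma>' * a^2 + \<delta>' * c^2 \<and> s * (c * \<beta> + d * \<delta>) = \<gamma>' * b^2 + \<delta>' * d^2"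
proof -
  have two': "(2::'a alg_closure) = 0"
    using two by (metis to_ac_0 to_ac_numeral)
  note ch = char2_simps[OF two] and ch' = char2_simps[OF two']
  obtain \<theta> where \<theta>: "ac_root \<gamma> \<alpha> \<delta> \<beta> \<theta>"
    using ex_ac_root anisotropic_lead_nonzero[OF an] by blast
  obtain \<eta> where \<eta>: "ac_root \<gamma>' \<alpha>' \<delta>' \<beta>' \<eta>"
    using ex_ac_root anisotropic_lead_nonzero[OF an'] by blast
  obtain a b c d where D0: "a * d - b * c \<noteq> 0"
    and mob: "\<eta> * (to_ac c * \<theta> + to_ac d) = to_ac a * \<theta> + to_ac b"
    using roots_projectively_equivalent[OF anisotropic_root_in_cubic_extension[OF two an \<theta>]
        anisotropic_root_in_cubic_extension[OF two an' \<eta>]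
        anisotropic_root_linear[OF an \<theta>] anisotropic_root_irrational[OF an' \<eta>]]
    by blast
  define m\<^sub>1\<^sub>1 m\<^sub>1\<^sub>2 m\<^sub>2\<^sub>1 m\<^sub>2\<^sub>2 where m: "m\<^sub>1\<^sub>1 = \<alpha>' * a^2 + \<beta>' * c^2" "m\<^sub>1\<^sub>2 = \<alpha>' * b^2 + \<beta>' * d^2"
    "m\<^sub>2\<^sub>1 = \<gamma>' * a^2 + \<delta>' * c^2" "m\<^sub>2\<^sub>2 = \<gamma>' * b^2 + \<delta>' * d^2"
  \<comment> \<open>With B having the rows \<open>(a, b)\<close> and \<open>(c, d)\<close>, the
    \<open>m\<close> are the entries of \<open>L' B\<^sup>(\<^sup>2\<^sup>)\<close>, and the
    \<open>g\<close> are the coefficients of the second cubic composed with B.\<close>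
  define g\<^sub>3 g\<^sub>2 g\<^sub>1 g\<^sub>0 where g: "g\<^sub>3 = a * m\<^sub>2\<^sub>1 + c * m\<^sub>1\<^sub>1" "g\<^sub>2 = b * m\<^sub>2\<^sub>1 + d * m\<^sub>1\<^sub>1"
    "g\<^sub>1 = a * m\<^sub>2\<^sub>2 + c * m\<^sub>1\<^sub>2" "g\<^sub>0 = b * m\<^sub>2\<^sub>2 + d * m\<^sub>1\<^sub>2"
  define D where "D = a * d + b * c"
  have D: "D \<noteq> 0"
    using D0 by (simp add: D_def ch)
  let ?w = "to_ac c * \<theta> + to_ac d"
  have "to_ac g\<^sub>3 * \<theta>^3 + to_ac g\<^sub>2 * \<theta>^2 + to_ac g\<^sub>1 * \<theta> + to_ac g\<^sub>0
    = to_ac \<gamma>' * (to_ac a * \<theta> + to_ac b)^3 + to_ac \<alpha>' * (to_ac a * \<theta> + to_ac b)^2 * ?w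
      + to_ac \<delta>' * (to_ac a * \<theta> + to_ac b) * ?w^2 + to_ac \<beta>' * ?w^3"
    by (simp add: g m algebra_simps power2_eq_square power3_eq_cube ch')
  also have "\<dots> = ?w^3 * (to_ac \<gamma>' * \<eta>^3 + to_ac \<alpha>' * \<eta>^2 + to_ac \<delta>' * \<eta> + to_ac \<beta>')"
    unfolding mob[symmetric] by (simp add: algebra_simps power2_eq_square power3_eq_cube)
  finally have g_root: "to_ac g\<^sub>3 * \<theta>^3 + to_ac g\<^sub>2 * \<theta>^2 + to_ac g\<^sub>1 * \<theta> + to_ac g\<^sub>0 = 0"
    by (simp only: \<eta>) simp
  have \<gamma>: "\<gamma> \<noteq> 0"
    using anisotropic_lead_nonzero[OF an] .
  \<comment> \<open>The composed cubic and the first cubic share the root \<open>\<theta>\<close>,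
    so they are proportional; the factor \<open>s * D\<close> is read off from the leading
    coefficients.\<close>
  define s where "s = g\<^sub>3 / (D * \<gamma>)"
  have g3: "g\<^sub>3 = s * D * \<gamma>"
    using D \<gamma> by (simp add: s_def)
  \<comment> \<open>Subtracting the multiple removes the cubic term; what remains is at most
    quadratic, vanishes at \<open>\<theta>\<close>, and is therefore zero.\<close>
  have "to_ac (g\<^sub>2 - s * D * \<alpha>) * \<theta>^2 + to_ac (g\<^sub>1 - s * D * \<delta>) * \<theta> + to_ac (g\<^sub>0 - s * D * \<beta>)
     = (to_ac g\<^sub>3 * \<theta>^3 + to_ac g\<^sub>2 * \<theta>^2 + to_ac g\<^sub>1 * \<theta> + to_ac g\<^sub>0)
       - to_ac (s * D) * (to_ac \<gamma> * \<theta>^3 + to_ac \<alpha> * \<theta>^2 + to_ac \<delta> * \<theta> + to_ac \<beta>)"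
    unfolding g3 by (simp add: algebra_simps)
  also have "\<dots> = 0"
    by (simp only: g_root \<theta>) simp
  finally have "g\<^sub>2 - s * D * \<alpha> = 0 \<and> g\<^sub>1 - s * D * \<delta> = 0 \<and> g\<^sub>0 - s * D * \<beta> = 0"
    by (rule anisotropic_root_quadratic[OF an \<theta>])
  then have gs: "g\<^sub>2 = s * D * \<alpha>" "g\<^sub>1 = s * D * \<delta>" "g\<^sub>0 = s * D * \<beta>"
    by simp_all
  have "s \<noteq> 0"
  \<comment> \<open>The leading coefficient of the composed cubic is the value of the second cubic
    at \<open>(a, c)\<close>, the first column of B.\<close>
  proof
    assume "s = 0"
    then have "binary_cubic \<gamma>' \<alpha>' \<delta>' \<beta>' a c = 0"
      using g3 by (simp add: binary_cubic_def g m algebra_simps power2_eq_square power3_eq_cube)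
    then have "a = 0 \<and> c = 0"
      using an' unfolding anisotropic_def by blast
    then show False
      using D0 by simp
  qed
  \<comment> \<open>Cramer's rule recovers the \<open>m\<close> from the \<open>g\<close>.\<close>
  moreover have "D * m\<^sub>1\<^sub>1 = a * g\<^sub>2 + b * g\<^sub>3" "D * m\<^sub>1\<^sub>2 = a * g\<^sub>0 + b * g\<^sub>1"
    "D * m\<^sub>2\<^sub>1 = c * g\<^sub>2 + d * g\<^sub>3" "D * m\<^sub>2\<^sub>2 = c * g\<^sub>0 + d * g\<^sub>1"
    unfolding g D_def by (simp_all add: algebra_simps ch)
  then have "D * m\<^sub>1\<^sub>1 = D * (s * (a * \<alpha> + b * \<gamma>))" "D * m\<^sub>1\<^sub>2 = D * (s * (a * \<beta> + b * \<delta>))"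
    "D * m\<^sub>2\<^sub>1 = D * (s * (c * \<alpha> + d * \<gamma>))" "D * m\<^sub>2\<^sub>2 = D * (s * (c * \<beta> + d * \<delta>))"
    unfolding gs g3 by (simp_all add: algebra_simps)
  then have "s * (a * \<alpha> + b * \<gamma>) = m\<^sub>1\<^sub>1" "s * (a * \<beta> + b * \<delta>) = m\<^sub>1\<^sub>2"
    "s * (c * \<alpha> + d * \<gamma>) = m\<^sub>2\<^sub>1" "s * (c * \<beta> + d * \<delta>) = m\<^sub>2\<^sub>2"
    using D by simp_all
  ultimately show ?thesis
    using D0 unfolding m by blast
qed

lemma ex_anisotropic_cubic:
  "\<exists>c\<^sub>2 c\<^sub>1 c\<^sub>0 :: 'a::{field,finite}. anisotropic 1 c\<^sub>2 c\<^sub>1 c\<^sub>0"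
proof -
  \<comment> \<open>The product of a monic linear and a monic quadratic polynomial; \<open>X\<^sup>2 (X - 1)\<close> is hit twice,
    so by counting some monic cubic is not hit.\<close>
  define f where "f = (\<lambda>(r, e, g :: 'a). (e - r, g - r * e, - (r * g)))"
  have "f (0, - 1, 0) = f (1, 0, 0)"
    by (simp add: f_def)
  then have "\<not> inj f"
    by (metis injD prod.inject zero_neq_one)
  then have "\<not> surj f"
    using finite_UNIV_surj_inj[of f] by auto
  then obtain c\<^sub>2 c\<^sub>1 c\<^sub>0 where c: "(c\<^sub>2, c\<^sub>1, c\<^sub>0) \<notin> range f"
    by (metis prod_cases3 surjI UNIV_I subsetI top.extremum_unique)
  have noroot: "r^3 + c\<^sub>2 * r^2 + c\<^sub>1 * r + c\<^sub>0 \<noteq> 0" for r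
  proof
    assume 0: "r^3 + c\<^sub>2 * r^2 + c\<^sub>1 * r + c\<^sub>0 = 0"
    have "c\<^sub>0 + r * (c\<^sub>1 + r * (c\<^sub>2 + r)) = 0"
      using 0 by (simp add: algebra_simps power2_eq_square power3_eq_cube)
    \<comment> \<open>Horner division by X - r supplies the quadratic cofactor.\<close>
    then have "(c\<^sub>2, c\<^sub>1, c\<^sub>0) = f (r, c\<^sub>2 + r, c\<^sub>1 + r * (c\<^sub>2 + r))"
      by (simp add: f_def eq_neg_iff_add_eq_0)
    then show False
      using c by blast
  qed
  have "x = 0 \<and> y = 0" if "binary_cubic 1 c\<^sub>2 c\<^sub>1 c\<^sub>0 x y = 0" for x y
  proof (cases "y = 0")
    case True
    then show ?thesis
      using that by (simp add: binary_cubic_def)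
  next
    case False
    have "binary_cubic 1 c\<^sub>2 c\<^sub>1 c\<^sub>0 x y = y^3 * ((x/y)^3 + c\<^sub>2 * (x/y)^2 + c\<^sub>1 * (x/y) + c\<^sub>0)"
      using False by (simp add: binary_cubic_def field_simps power2_eq_square power3_eq_cube)
    then show ?thesis
      using that noroot[of "x / y"] False by simp
  qed
  then show ?thesis
    unfolding anisotropic_def by blast
qed

subsection \<open>Counting\<close>

lemma card_eq_mult_card_image:
  assumes "finite A" "\<And>x. x \<in> A \<Longrightarrow> card {y \<in> A. f y = f x} = c"
  shows "card A = c * card (f ` A)"
proof -
  have "card A = (\<Sum>z\<in>f ` A. card {y \<in> A. f y = z})"
    using sum.image_gen[OF assms(1), of "\<lambda>_. 1::nat" f] by simp
  also have "\<dots> = (\<Sum>z\<in>f ` A. c)"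
    using assms(2) by (intro sum.cong) auto
  finally show ?thesis
    by simp
qed

text \<open>The fibres of \<open>f\<close> are the cosets of \<open>K\<close>: a counting form of
  the isomorphism theorem that asks for no group structure on the target.\<close>

lemma card_eq_card_kernel_mult_card_image:
  fixes A :: "'g::ab_group_add set"
  assumes "finite A" "\<And>x k. x \<in> A \<Longrightarrow> k \<in> K \<Longrightarrow> x + k \<in> A"
    and "\<And>x y. x \<in> A \<Longrightarrow> y \<in> A \<Longrightarrow> f x = f y \<longleftrightarrow> y - x \<in> K"
  shows "card A = card K * card (f ` A)"
proof (rule card_eq_mult_card_image[OF assms(1)])
  fix x assume x: "x \<in> A"
  have "{y \<in> A. f y = f x} = (+) x ` K"
  proof (intro equalityI subsetI)
    fix y assume "y \<in> {y \<in> A. f y = f x}"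
    then have "y - x \<in> K"
      using assms(3)[OF x, of y] by auto
    then show "y \<in> (+) x ` K"
      by (intro image_eqI[of _ _ "y - x"]) auto
  next
    fix y assume "y \<in> (+) x ` K"
    then obtain k where "k \<in> K" "y = x + k"
      by blast
    then show "y \<in> {y \<in> A. f y = f x}"
      using assms(2)[OF x] assms(3)[OF x, of y] by auto
  qed
  then show "card {y \<in> A. f y = f x} = card K"
    by (simp add: card_image)
qed

lemma mat_scale_eq_iff:
  "M \<noteq> 0 \<Longrightarrow> mat_scale k M = mat_scale l M \<longleftrightarrow> k = l"
  using mats.scale_right_imp_eq by blast

text \<open>Passage from vectors to projective objects: each fibre consists of the q - 1 nonzero
  multiples of one matrix. It serves for points (\<open>f\<close> the span) and for hyperplanes
  (\<open>f\<close> the map \<open>hyperplane_of\<close>).\<close>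

lemma card_eq_mult_card_projective_image:
  fixes A :: "('a::{field,finite}^'n::finite^'m::finite) set"
  assumes "\<And>M k. M \<in> A \<Longrightarrow> k \<noteq> 0 \<Longrightarrow> mat_scale k M \<in> A" "0 \<notin> A"
    and "\<And>M N. M \<in> A \<Longrightarrow> N \<in> A \<Longrightarrow> f M = f N \<longleftrightarrow> (\<exists>k. k \<noteq> 0 \<and> N = mat_scale k M)"
  shows "card A = (CARD('a) - 1) * card (f ` A)"
proof (rule card_eq_mult_card_image)
  fix M assume M: "M \<in> A"
  have "{N \<in> A. f N = f M} = (\<lambda>k. mat_scale k M) ` (UNIV - {0})"
  proof (intro equalityI subsetI)
    fix N assume "N \<in> {N \<in> A. f N = f M}"
    then show "N \<in> (\<lambda>k. mat_scale k M) ` (UNIV - {0})"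
      using assms(3)[OF M, of N] by auto
  next
    fix N assume "N \<in> (\<lambda>k. mat_scale k M) ` (UNIV - {0})"
    then show "N \<in> {N \<in> A. f N = f M}"
      using assms(1)[OF M] assms(3)[OF M, of N] by auto
  qed
  moreover have "inj_on (\<lambda>k. mat_scale k M) (UNIV - {0})"
    using M assms(2) by (intro inj_onI) (metis mat_scale_eq_iff)
  ultimately show "card {N \<in> A. f N = f M} = CARD('a) - 1"
    by (simp add: card_image card_Diff_singleton)
qed simp

section \<open>Cardinalities of subspaces and their points\<close>

lemma card_span_independent:
  fixes B :: "('a::{field,finite}^'n::finite^'m::finite) set"
  assumes "mats.independent B"
  shows "card (mats.span B) = CARD('a) ^ card B"
proof -
  have "finite B"
    by simp
  then show ?thesis
    using assms
  proof (induction B rule: finite_induct)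
    case (insert b B)
    have b: "b \<notin> mats.span B" and B: "mats.independent B"
      using insert.prems insert.hyps by (simp_all add: mats.independent_insert)
    let ?f = "\<lambda>(k, s). mat_scale k b + s"
    have "mats.span (insert b B) = ?f ` (UNIV \<times> mats.span B)"
    proof (intro equalityI subsetI)
      fix x assume "x \<in> mats.span (insert b B)"
      then obtain k where "x - mat_scale k b \<in> mats.span B"
        unfolding mats.span_insert by blast
      then show "x \<in> ?f ` (UNIV \<times> mats.span B)"
        by (intro image_eqI[of _ _ "(k, x - mat_scale k b)"]) auto
    next
      fix x assume "x \<in> ?f ` (UNIV \<times> mats.span B)"
      then obtain k s where "s \<in> mats.span B" "x = mat_scale k b + s"
        by auto
      then show "x \<in> mats.span (insert b B)"
        unfolding mats.span_insert by (auto intro!: exI[of _ k])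
    qed
    moreover have "inj_on ?f (UNIV \<times> mats.span B)"
    proof (clarsimp simp: inj_on_def)
      fix k s l t
      assume st: "s \<in> mats.span B" "t \<in> mats.span B" and eq: "mat_scale k b + s = mat_scale l b + t"
      have "mat_scale (k - l) b = t - s"
        using eq by (simp add: mats.scale_left_diff_distrib algebra_simps)
      then have sp: "mat_scale (k - l) b \<in> mats.span B"
        using st by (simp add: mats.span_diff)
      have "k = l"
      proof (rule ccontr)
        assume "k \<noteq> l"
        then have "b \<in> mats.span B"
          using mats.span_scale[OF sp, of "1 / (k - l)"] by simp
        then show False
          using b by blast
      qed
      then show "k = l \<and> s = t"
        using eq by simp
    qed
    ultimately show ?case
      using insert B by (simp add: card_image card_cartesian_product)
  qed simp
qed

text \<open>Turns dimensions into cardinalities, so that dimensions and equalities of subspaces can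
  be settled by counting.\<close>

lemma card_subspace:
  fixes U :: "('a::{field,finite}^'n::finite^'m::finite) set"
  assumes "mats.subspace U"
  shows "card U = CARD('a) ^ mats.dim U"
proof -
  obtain B where B: "B \<subseteq> U" "mats.independent B" "U \<subseteq> mats.span B" "card B = mats.dim U"
    using mats.basis_exists[of U] by blast
  have "mats.span B = U"
    using B assms by (meson mats.span_minimal subset_antisym)
  then show ?thesis
    using card_span_independent[OF B(2)] B(4) by simp
qed

lemma span_singleton_subset_iff:
  "mats.subspace U \<Longrightarrow> mats.span {M} \<subseteq> U \<longleftrightarrow> M \<in> U"
  by (metis bot.extremum insert_subset mats.span_base mats.span_minimal insertI1 subsetD)

lemma points_in_subspace:
  assumes "mats.subspace U" "U \<subseteq> sym_mats"
  shows "{P \<in> pg5_subspaces 0. P \<subseteq> U} = (\<lambda>M. mats.span {M}) ` (U - {0})"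
proof (intro equalityI subsetI)
  fix P assume "P \<in> {P \<in> pg5_subspaces 0. P \<subseteq> U}"
  then have P: "mats.subspace P" "mats.dim P = 1" "P \<subseteq> U"
    by (auto simp: pg5_subspaces_def)
  obtain B where B: "B \<subseteq> P" "mats.independent B" "P \<subseteq> mats.span B" "card B = mats.dim P"
    using mats.basis_exists[of P] by blast
  then obtain M where M: "B = {M}"
    using P(2) by (metis card_1_singletonE)
  have "mats.span {M} = P"
    using B P(1) unfolding M by (meson mats.span_minimal subset_antisym)
  moreover have "M \<noteq> 0"
    using B(2) M by simp
  ultimately show "P \<in> (\<lambda>M. mats.span {M}) ` (U - {0})"
    using B(1) M P(3) by blast
next
  fix P assume "P \<in> (\<lambda>M. mats.span {M}) ` (U - {0})"
  then obtain M where M: "M \<in> U" "M \<noteq> 0" "P = mats.span {M}"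
    by blast
  have "mats.dim P = 1"
    unfolding M(3) using M(2) by (subst mats.dim_span_eq_card_independent) auto
  moreover have "P \<subseteq> U"
    using M assms(1) span_singleton_subset_iff by blast
  ultimately show "P \<in> {P \<in> pg5_subspaces 0. P \<subseteq> U}"
    using assms(2) M(3) by (auto simp: pg5_subspaces_def)
qed

lemma span_singleton_eq_iff:
  assumes "M \<noteq> 0" "N \<noteq> 0"
  shows "mats.span {M} = mats.span {N} \<longleftrightarrow> (\<exists>k. k \<noteq> 0 \<and> N = mat_scale k M)"
proof
  assume "mats.span {M} = mats.span {N}"
  then have "N \<in> mats.span {M}"
    by (simp add: mats.span_base)
  then show "\<exists>k. k \<noteq> 0 \<and> N = mat_scale k M"
    using assms by (auto simp: mats.span_singleton)
next
  assume "\<exists>k. k \<noteq> 0 \<and> N = mat_scale k M"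
  then obtain k where k: "k \<noteq> 0" "N = mat_scale k M"
    by blast
  then have "M = mat_scale (1 / k) N"
    by simp
  then show "mats.span {M} = mats.span {N}"
    using k by (metis insertI1 mats.span_base mats.span_scale mats.subspace_span
        span_singleton_subset_iff subset_antisym)
qed

lemma card_points_in_subspace:
  fixes U :: "('a::{field,finite}^3^3) set"
  assumes "mats.subspace U" "U \<subseteq> sym_mats"
  shows "card U - 1 = (CARD('a) - 1) * card {P \<in> pg5_subspaces 0. P \<subseteq> U}"
proof -
  have "card (U - {0}) = (CARD('a) - 1) * card ((\<lambda>M. mats.span {M}) ` (U - {0}))"
    using assms by (intro card_eq_mult_card_projective_image)
      (auto simp: mats.subspace_scale span_singleton_eq_iff)
  then show ?thesis
    using assms by (simp add: points_in_subspace mats.subspace_0)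
qed

no_notation fps_nth (infixl "$" 75)

subsection \<open>Matrices of size three\<close>

text \<open>The general facts enumerate the index type as 1, 2, 3; this rewriting adapts them to the
  coordinates 0, 1, 2.\<close>

lemma three_eq_zero: "(3::3) = 0"
  by simp

lemma all_3: "(\<forall>i::3. P i) \<longleftrightarrow> P 0 \<and> P 1 \<and> P 2"
  unfolding forall_3 three_eq_zero by blast

lemma sum_3': "sum f (UNIV::3 set) = f 0 + f 1 + f 2"
  unfolding sum_3 three_eq_zero by (simp add: add_ac)

lemma less_3 [simp]: "(0::3) < 1" "(0::3) < 2" "(1::3) < 2"
  by (simp_all add: less_bit1_def bit1.Rep_0 bit1.Rep_1 bit1.Rep_numeral)

lemma atLeast_3: "{0..} = {0, 1, 2::3}" "{1..} = {1, 2::3}" "{2..} = {2::3}"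
proof -
  have "i \<in> {0..} \<longleftrightarrow> i \<in> {0, 1, 2}" "i \<in> {1..} \<longleftrightarrow> i \<in> {1, 2}" "i \<in> {2..} \<longleftrightarrow> i \<in> {2}" for i :: 3
    using exhaust_3[of i, unfolded three_eq_zero] less_3
    by (auto simp: not_le[symmetric] simp del: not_le)
  note this[THEN Set.set_eqI]
  then show "{0..} = {0, 1, 2::3}" "{1..} = {1, 2::3}" "{2..} = {2::3}" .
qed

lemma mat3_eq_iff:
  fixes M N :: "'b^3^3"
  shows "M = N \<longleftrightarrow> M$0$0 = N$0$0 \<and> M$0$1 = N$0$1 \<and> M$0$2 = N$0$2 \<and>
    M$1$0 = N$1$0 \<and> M$1$1 = N$1$1 \<and> M$1$2 = N$1$2 \<and>
    M$2$0 = N$2$0 \<and> M$2$1 = N$2$1 \<and> M$2$2 = N$2$2"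
  by (auto simp: vec_eq_iff all_3)

definition mat3 :: "'b \<Rightarrow> 'b \<Rightarrow> 'b \<Rightarrow> 'b \<Rightarrow> 'b \<Rightarrow> 'b \<Rightarrow> 'b \<Rightarrow> 'b \<Rightarrow> 'b \<Rightarrow> 'b^3^3" where
  "mat3 a b c d e f g h k = (\<chi> i j.
     if i = 0 then (if j = 0 then a else if j = 1 then b else c)
     else if i = 1 then (if j = 0 then d else if j = 1 then e else f)
     else (if j = 0 then g else if j = 1 then h else k))"

lemma mat3_nth [simp]:
  "mat3 a b c d e f g h k $ 0 $ 0 = a" "mat3 a b c d e f g h k $ 0 $ 1 = b"
  "mat3 a b c d e f g h k $ 0 $ 2 = c" "mat3 a b c d e f g h k $ 1 $ 0 = d"
  "mat3 a b c d e f g h k $ 1 $ 1 = e" "mat3 a b c d e f g h k $ 1 $ 2 = f"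
  "mat3 a b c d e f g h k $ 2 $ 0 = g" "mat3 a b c d e f g h k $ 2 $ 1 = h"
  "mat3 a b c d e f g h k $ 2 $ 2 = k"
  by (simp_all add: mat3_def)

lemma mat_scale_nth [simp]: "mat_scale c M $ i $ j = c * M $ i $ j"
  by (simp add: mat_scale_def)

lemma mult3_nth: "((A::'b::semiring_1^3^3) ** B) $ i $ j = A$i$0 * B$0$j + A$i$1 * B$1$j + A$i$2 * B$2$j"
  by (simp add: matrix_matrix_mult_def sum_3')

lemma transpose_nth: "transpose A $ i $ j = A $ j $ i"
  by (simp add: transpose_def)

lemma det_3':
  fixes M :: "'b::comm_ring_1^3^3"
  shows "det M = M$0$0 * M$1$1 * M$2$2 + M$0$1 * M$1$2 * M$2$0 + M$0$2 * M$1$0 * M$2$1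
    - M$0$0 * M$1$2 * M$2$1 - M$0$1 * M$1$0 * M$2$2 - M$0$2 * M$1$1 * M$2$0"
  unfolding det_3 three_eq_zero by (simp add: algebra_simps)

lemma sym_mats_iff: "M \<in> sym_mats \<longleftrightarrow> M$1$0 = M$0$1 \<and> M$2$0 = M$0$2 \<and> M$2$1 = M$1$2"
  unfolding sym_mats_def by (auto simp: mat3_eq_iff transpose_nth)

lemma nucleus_plane_iff:
  "M \<in> nucleus_plane \<longleftrightarrow> M \<in> sym_mats \<and> M$0$0 = 0 \<and> M$1$1 = 0 \<and> M$2$2 = 0"
  unfolding nucleus_plane_def by (auto simp: all_3)

lemma subspace_sym_mats: "mats.subspace sym_mats"
  by (auto simp: mats.subspace_def sym_mats_iff)

lemma subspace_nucleus_plane: "mats.subspace nucleus_plane"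
  by (auto simp: mats.subspace_def nucleus_plane_iff sym_mats_iff)

text \<open>By symmetry the two triple products of off-diagonal entries are equal and
  cancel.\<close>

lemma det_sym_char2:
  fixes M :: "'b::field^3^3"
  assumes two: "(2::'b) = 0" and "M \<in> sym_mats"
  shows "det M = M$0$0 * M$1$1 * M$2$2 + M$0$0 * (M$1$2)^2 + M$1$1 * (M$0$2)^2 + M$2$2 * (M$0$1)^2"
  using assms(2) by (simp add: det_3' sym_mats_iff power2_eq_square algebra_simps char2_simps[OF two])

lemma det_nucleus_plane:
  fixes M :: "'b::field^3^3"
  assumes "(2::'b) = 0" "M \<in> nucleus_plane"
  shows "det M = 0"
  using assms by (simp add: det_sym_char2 nucleus_plane_iff)

section \<open>The rank of a matrix of size three\<close>

lemma rank_le_3: "rank (M::'a::field^3^3) \<le> 3"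
  unfolding row_rank_def_gen using dim_subset_UNIV_cart_gen[of "rows M"] by simp

lemma rank_eq_3_iff: "rank (M::'a::field^3^3) = 3 \<longleftrightarrow> det M \<noteq> 0"
proof -
  have "det M \<noteq> 0 \<longleftrightarrow> vec.span (rows M) = UNIV"
    unfolding invertible_det_nz[symmetric] invertible_left_inverse matrix_left_invertible_span_rows_gen ..
  also have "\<dots> \<longleftrightarrow> vec.dim (rows M) = vec.dim (UNIV :: ('a^3) set)"
    by (metis vec.dim_eq_full vec.dim_UNIV vec.dimension_def)
  finally show ?thesis
    by (simp add: row_rank_def_gen vec_dim_card del: vec.dim_UNIV)
qed

lemma rank_eq_0_iff: "rank (M::'a::field^3^3) = 0 \<longleftrightarrow> M = 0"
proof -
  have "rank M = 0 \<longleftrightarrow> (\<forall>i. row i M = 0)"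
    unfolding row_rank_def_gen vec.dim_eq_0 rows_def by blast
  then show ?thesis
    by (simp add: row_def vec_eq_iff)
qed

lemma rank_mat_scale_le: "rank (mat_scale c (M::'a::field^3^3)) \<le> rank M"
  unfolding row_rank_def_gen
proof (rule vec.dim_mono, rule subsetI)
  fix v assume "v \<in> rows (mat_scale c M)"
  then obtain i where "v = row i (mat_scale c M)"
    by (auto simp: rows_def)
  then have "v = c *s row i M"
    by (simp add: row_def vec_eq_iff)
  moreover have "row i M \<in> rows M"
    by (auto simp: rows_def)
  ultimately show "v \<in> vec.span (rows M)"
    by (simp add: vec.span_scale vec.span_base)
qed

lemma rank_mat_scale: "c \<noteq> 0 \<Longrightarrow> rank (mat_scale c (M::'a::field^3^3)) = rank M"
  using rank_mat_scale_le[of c M] rank_mat_scale_le[of "1/c" "mat_scale c M"] by simp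

text \<open>All rows are multiples of one vector, so the entries factor as
  \<open>t m * v $ n\<close>.\<close>

lemma rank_le_1_minors:
  fixes M :: "'a::field^3^3"
  assumes "rank M \<le> 1"
  shows "M$i$j * M$k$l = M$i$l * M$k$j"
proof -
  obtain B where B: "B \<subseteq> rows M" "vec.independent B" "rows M \<subseteq> vec.span B" "card B = vec.dim (rows M)"
    using vec.basis_exists[of "rows M"] by blast
  have "finite B"
    using B(2) by (rule vec.finiteI_independent)
  then obtain v where "B \<subseteq> {v}"
    using assms B(4) unfolding row_rank_def_gen
    by (metis card_0_eq card_1_singletonE empty_subsetI le_SucE le_zero_eq One_nat_def subset_refl)
  then have "rows M \<subseteq> vec.span {v}"
    using B(3) vec.span_mono by blast
  then have "\<exists>t. row m M = t *s v" for m
    by (auto simp: rows_def vec.span_singleton)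
  then obtain t where t: "\<And>m. row m M = t m *s v"
    by metis
  have "M$m$n = t m * v$n" for m n
    using arg_cong[OF t[of m], of "\<lambda>w. w$n"] by (simp add: row_def)
  then show ?thesis
    by simp
qed

text \<open>With zero diagonal, the principal 2 by 2 minors are, up to sign, the squares of the
  off-diagonal entries, so rank at most 1 would force \<open>M = 0\<close>; rank 3 is excluded by
  the determinant.\<close>

lemma rank_nucleus_plane:
  fixes M :: "'a::field^3^3"
  assumes two: "(2::'a) = 0" and M: "M \<in> nucleus_plane" "M \<noteq> 0"
  shows "rank M = 2"
proof -
  have "\<not> rank M \<le> 1"
  proof
    assume r: "rank M \<le> 1"
    have s: "M$1$0 = M$0$1" "M$2$0 = M$0$2" "M$2$1 = M$1$2" "M$0$0 = 0" "M$1$1 = 0" "M$2$2 = 0"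
      using M(1) by (auto simp: nucleus_plane_iff sym_mats_iff)
    have "M$0$1 = 0" "M$0$2 = 0" "M$1$2 = 0"
      using rank_le_1_minors[OF r, of 0 1 1 0] rank_le_1_minors[OF r, of 0 2 2 0]
        rank_le_1_minors[OF r, of 1 2 2 1] by (auto simp: s)
    then show False
      using M(2) s by (simp add: mat3_eq_iff)
  qed
  moreover have "rank M \<noteq> 3"
    using det_nucleus_plane[OF two M(1)] by (simp add: rank_eq_3_iff)
  ultimately show ?thesis
    using rank_le_3[of M] by linarith
qed

subsection \<open>Planes with a single singular point\<close>

text \<open>The point-orbit distribution [0,1,0,q^2+q] expressed by a generating matrix and
  determinants; the zero matrix is covered by the span.\<close>

definition only_singular_point :: "'a::field^3^3 \<Rightarrow> ('a^3^3) set \<Rightarrow> bool" where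
  "only_singular_point M W \<longleftrightarrow> M \<in> W \<and> M \<in> nucleus_plane \<and> M \<noteq> 0 \<and>
     (\<forall>N\<in>W. det N = 0 \<longrightarrow> N \<in> mats.span {M})"

lemma span_singleton_in_rank_points:
  assumes "M \<in> sym_mats" "M \<noteq> 0"
  shows "mats.span {M} \<in> rank_points (rank M)"
proof -
  have "mats.span {M} \<in> {P \<in> pg5_subspaces 0. P \<subseteq> sym_mats}"
    unfolding points_in_subspace[OF subspace_sym_mats subset_refl] using assms by blast
  moreover have "rank N = rank M" if "N \<in> mats.span {M} - {0}" for N
    using that by (auto simp: mats.span_singleton intro!: rank_mat_scale)
  ultimately show ?thesis
    by (auto simp: rank_points_def)
qed

lemma rank_pointsE:
  assumes "P \<in> rank_points r"
  obtains M where "M \<in> sym_mats" "M \<noteq> 0" "P = mats.span {M}" "rank M = r"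
proof -
  have "P \<in> {P \<in> pg5_subspaces 0. P \<subseteq> sym_mats}"
    using assms by (auto simp: rank_points_def pg5_subspaces_def)
  then obtain M where "M \<in> sym_mats" "M \<noteq> 0" "P = mats.span {M}"
    unfolding points_in_subspace[OF subspace_sym_mats subset_refl] by blast
  moreover have "rank M = r"
    using assms calculation by (auto simp: rank_points_def mats.span_base)
  ultimately show ?thesis
    using that by blast
qed

text \<open>Points of rank below 3 are those of determinant 0. The first three entries say that
  there is exactly one of them and that it lies in the nucleus plane; the other q^2 + q of the q^2 +
  q + 1 points of the plane have rank 3.\<close>

lemma point_orbit_distribution_iff:
  fixes W :: "('a::{field,finite}^3^3) set"
  assumes two: "(2::'a) = 0" and W: "W \<in> pg5_subspaces 2"
  shows "point_orbit_distribution W = (0, 1, 0, CARD('a)^2 + CARD('a)) \<longleftrightarrow>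
    (\<exists>M. only_singular_point M W)"
proof
  have sub: "mats.subspace W" "W \<subseteq> sym_mats" "mats.dim W = 3"
    using W by (auto simp: pg5_subspaces_def)
  {
    assume "point_orbit_distribution W = (0, 1, 0, CARD('a)^2 + CARD('a))"
    then have c: "card {P \<in> rank_points 1. P \<subseteq> W} = 0"
      "card {P \<in> rank_points 2. P \<subseteq> W \<inter> nucleus_plane} = 1"
      "card {P \<in> rank_points 2. P \<subseteq> W \<and> \<not> P \<subseteq> nucleus_plane} = 0"
      by (auto simp: point_orbit_distribution_def)
    obtain P where P: "{P \<in> rank_points 2. P \<subseteq> W \<inter> nucleus_plane} = {P}"
      using c(2) by (rule card_1_singletonE)
    then have "P \<in> rank_points 2" and PW: "P \<subseteq> W \<inter> nucleus_plane"
      by blast+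
    then obtain M where M: "M \<noteq> 0" "P = mats.span {M}"
      by (elim rank_pointsE)
    have "N \<in> mats.span {M}" if N: "N \<in> W" "det N = 0" for N
    proof (cases "N = 0")
      case False
      have NW: "mats.span {N} \<subseteq> W" and Nr: "mats.span {N} \<in> rank_points (rank N)"
        using N(1) sub False by (auto simp: span_singleton_subset_iff span_singleton_in_rank_points)
      have "rank N \<noteq> 0" "rank N \<noteq> 3" "rank N \<noteq> 1"
        using False N(2) c(1) NW Nr by (auto simp: rank_eq_0_iff rank_eq_3_iff)
      then have "rank N = 2"
        using rank_le_3[of N] by linarith
      then have "mats.span {N} \<in> {P \<in> rank_points 2. P \<subseteq> W \<inter> nucleus_plane}"
        using c(3) NW Nr by auto
      then have "mats.span {N} = mats.span {M}"
        unfolding P M by blast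
      then show ?thesis
        by (metis insertI1 mats.span_base)
    qed (simp add: mats.span_zero)
    moreover have "M \<in> W" "M \<in> nucleus_plane"
      using PW M by (auto simp: mats.span_base)
    ultimately have "only_singular_point M W"
      using M(1) unfolding only_singular_point_def by blast
    then show "\<exists>M. only_singular_point M W" ..
  }
  assume "\<exists>M. only_singular_point M W"
  then obtain M where M: "M \<in> W" "M \<in> nucleus_plane" "M \<noteq> 0"
    and sing: "\<And>N. N \<in> W \<Longrightarrow> det N = 0 \<Longrightarrow> N \<in> mats.span {M}"
    unfolding only_singular_point_def by blast
  have MN: "mats.span {M} \<subseteq> W \<inter> nucleus_plane"
    using M span_singleton_subset_iff[OF sub(1)] span_singleton_subset_iff[OF subspace_nucleus_plane]
    by blast
  have M2: "mats.span {M} \<in> rank_points 2"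
    using span_singleton_in_rank_points[of M] M sub rank_nucleus_plane[OF two] by auto
  have low: "P = mats.span {M}" if P: "P \<in> rank_points r" "r \<noteq> 3" "P \<subseteq> W" for P r
  proof -
    obtain N where N: "N \<noteq> 0" "P = mats.span {N}" "rank N = r"
      using P(1) by (elim rank_pointsE)
    then have "N \<in> W" "det N = 0"
      using P rank_eq_3_iff[of N] by (auto simp: mats.span_base)
    then have "N \<in> mats.span {M}"
      by (rule sing)
    then obtain k where k: "N = mat_scale k M"
      by (auto simp: mats.span_singleton)
    then have "k \<noteq> 0"
      using N(1) by auto
    then show ?thesis
      using span_singleton_eq_iff[OF M(3) N(1)] k N(2) by blast
  qed
  have rank_unique: "r = 2" if "mats.span {M} \<in> rank_points r" for r
    using that rank_nucleus_plane[OF two M(2,3)] M(3) by (auto simp: rank_points_def mats.span_base)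
  have low2: "P = mats.span {M}" if "P \<in> rank_points 2" "P \<subseteq> W" for P
    using low[of P 2] that by simp
  have "{P \<in> rank_points 1. P \<subseteq> W} = {}"
    using low[of _ 1] rank_unique[of 1] by auto
  moreover have "{P \<in> rank_points 2. P \<subseteq> W \<inter> nucleus_plane} = {mats.span {M}}"
    using low2 M2 MN by blast
  moreover have "{P \<in> rank_points 2. P \<subseteq> W \<and> \<not> P \<subseteq> nucleus_plane} = {}"
    using low2 MN by blast
  moreover have "card {P \<in> rank_points 3. P \<subseteq> W} = CARD('a)^2 + CARD('a)"
  proof -
    have "{P \<in> rank_points 3. P \<subseteq> W} = {P \<in> pg5_subspaces 0. P \<subseteq> W} - {mats.span {M}}"
    proof (intro equalityI subsetI)
      fix P assume "P \<in> {P \<in> rank_points 3. P \<subseteq> W}"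
      then show "P \<in> {P \<in> pg5_subspaces 0. P \<subseteq> W} - {mats.span {M}}"
        using rank_unique[of 3] by (auto simp: rank_points_def)
    next
      fix P assume P: "P \<in> {P \<in> pg5_subspaces 0. P \<subseteq> W} - {mats.span {M}}"
      then obtain N where N: "N \<in> W" "N \<noteq> 0" "P = mats.span {N}"
        unfolding points_in_subspace[OF sub(1,2)] by blast
      then have "P \<in> rank_points (rank N)"
        using span_singleton_in_rank_points sub by blast
      moreover have "rank N = 3"
        using low[of P "rank N"] calculation P by blast
      ultimately show "P \<in> {P \<in> rank_points 3. P \<subseteq> W}"
        using P by simp
    qed
    moreover have "mats.span {M} \<in> {P \<in> pg5_subspaces 0. P \<subseteq> W}"
      unfolding points_in_subspace[OF sub(1,2)] using M by (intro image_eqI[OF refl]) simp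
    ultimately have "card {P \<in> rank_points 3. P \<subseteq> W} = card {P \<in> pg5_subspaces 0. P \<subseteq> W} - 1"
      by (simp add: card_Diff_singleton)
    moreover have "card {P \<in> pg5_subspaces 0. P \<subseteq> W} = CARD('a)^2 + CARD('a) + 1"
    proof -
      have "CARD('a)^3 - 1 = (CARD('a) - 1) * (CARD('a)^2 + CARD('a) + 1)"
        using card_field_gt_1[where 'a = 'a]
        by (cases "CARD('a)") (simp_all add: algebra_simps power2_eq_square power3_eq_cube)
      moreover have "CARD('a)^3 - 1 = (CARD('a) - 1) * card {P \<in> pg5_subspaces 0. P \<subseteq> W}"
        using card_points_in_subspace[OF sub(1,2)] card_subspace[OF sub(1)] sub(3) by simp
      ultimately have "(CARD('a) - 1) * card {P \<in> pg5_subspaces 0. P \<subseteq> W}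
          = (CARD('a) - 1) * (CARD('a)^2 + CARD('a) + 1)"
        by simp
      then show ?thesis
        using card_field_gt_1[where 'a = 'a] unfolding mult_cancel1 by simp
    qed
    ultimately show ?thesis
      by simp
  qed
  ultimately show "point_orbit_distribution W = (0, 1, 0, CARD('a)^2 + CARD('a))"
    by (simp add: point_orbit_distribution_def)
qed

section \<open>The action of K by congruence\<close>

lemma congruence_add:
  fixes A B M N :: "'a::field^3^3"
  shows "A ** (M + N) ** B = A ** M ** B + A ** N ** B"
  by (simp add: mat3_eq_iff mult3_nth algebra_simps)

lemma congruence_scale:
  fixes A B M :: "'a::field^3^3"
  shows "A ** mat_scale c M ** B = mat_scale c (A ** M ** B)"
  by (simp add: mat3_eq_iff mult3_nth algebra_simps)

lemma congruence_sym_mats: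
  assumes "M \<in> sym_mats" shows "A ** M ** transpose A \<in> sym_mats"
  using assms by (simp add: sym_mats_def matrix_transpose_mul matrix_mul_assoc)

text \<open>Off-diagonal entries contribute to the new diagonal in equal pairs, which
  cancel.\<close>

lemma congruence_nucleus_plane:
  fixes A :: "'a::field^3^3"
  assumes two: "(2::'a) = 0" and "M \<in> nucleus_plane"
  shows "A ** M ** transpose A \<in> nucleus_plane"
proof -
  have "M \<in> sym_mats"
    using assms by (simp add: nucleus_plane_iff)
  then show ?thesis
    using assms(2) congruence_sym_mats[of M A]
    by (simp add: nucleus_plane_iff sym_mats_iff mult3_nth transpose_nth algebra_simps char2_simps[OF two])
qed

lemma K_map_compose: "K_map A (K_map B U) = K_map (A ** B) U"
  by (simp add: K_map_def image_image matrix_transpose_mul matrix_mul_assoc)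

lemma K_map_mat_1: "K_map (mat 1) U = U"
  by (simp add: K_map_def transpose_mat)

lemma ex_K_map_inverse:
  assumes "invertible A"
  shows "\<exists>B. invertible B \<and> (\<forall>U. K_map B (K_map A U) = U)"
proof -
  obtain B where "A ** B = mat 1" "B ** A = mat 1"
    using assms unfolding invertible_def by blast
  then show ?thesis
    by (intro exI[of _ B]) (auto simp: K_map_compose K_map_mat_1 invertible_def)
qed

lemma K_orbit_eq: "K_orbit U = {K_map A U | A. invertible A}"
  by (auto simp: K_orbit_def K_group_def)

lemma inj_congruence:
  fixes A :: "'a::field^3^3"
  assumes "invertible A" shows "inj (\<lambda>M. A ** M ** transpose A)"
proof -
  obtain B where B: "B ** A = mat 1"
    using assms unfolding invertible_def by blast
  have "transpose A ** transpose B = mat 1"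
    using arg_cong[OF B, of transpose] by (simp add: matrix_transpose_mul transpose_mat)
  then have "B ** (A ** M ** transpose A) ** transpose B = M" for M
    by (metis B matrix_mul_assoc matrix_mul_lid matrix_mul_rid)
  then show ?thesis
    by (rule inj_on_inverseI)
qed

lemma card_K_map:
  fixes A :: "'a::{field,finite}^3^3"
  assumes "invertible A" shows "card (K_map A U) = card U"
  unfolding K_map_def using inj_congruence[OF assms] by (metis card_image inj_on_subset subset_UNIV)

text \<open>Congruence is linear and injective; the dimension is preserved because the cardinality
  is.\<close>

lemma K_map_pg5_subspaces:
  fixes A :: "'a::{field,finite}^3^3"
  assumes A: "invertible A" and U: "U \<in> pg5_subspaces d"
  shows "K_map A U \<in> pg5_subspaces d"
proof -
  have sub: "mats.subspace U" "U \<subseteq> sym_mats" "mats.dim U = d + 1"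
    using U by (auto simp: pg5_subspaces_def)
  have sub': "mats.subspace (K_map A U)"
    unfolding K_map_def
  proof (rule mats.subspaceI)
    show "0 \<in> (\<lambda>M. A ** M ** transpose A) ` U"
      using mats.subspace_0[OF sub(1)] by (intro image_eqI[of _ _ 0]) auto
  next
    fix x y assume "x \<in> (\<lambda>M. A ** M ** transpose A) ` U" "y \<in> (\<lambda>M. A ** M ** transpose A) ` U"
    then show "x + y \<in> (\<lambda>M. A ** M ** transpose A) ` U"
      using mats.subspace_add[OF sub(1)] by (auto simp: image_iff simp flip: congruence_add)
  next
    fix c x assume "x \<in> (\<lambda>M. A ** M ** transpose A) ` U"
    then show "mat_scale c x \<in> (\<lambda>M. A ** M ** transpose A) ` U"
      using mats.subspace_scale[OF sub(1)] by (auto simp: image_iff simp flip: congruence_scale)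
  qed
  moreover have "K_map A U \<subseteq> sym_mats"
    using sub(2) congruence_sym_mats by (auto simp: K_map_def)
  moreover have "CARD('a) ^ mats.dim (K_map A U) = CARD('a) ^ (d + 1)"
    using card_K_map[OF A, of U] card_subspace[OF sub'] card_subspace[OF sub(1)] sub(3) by simp
  then have "mats.dim (K_map A U) = d + 1"
    using card_field_gt_1[where 'a = 'a] power_inject_exp by blast
  ultimately show ?thesis
    by (simp add: pg5_subspaces_def)
qed

text \<open>Congruence multiplies determinants by the nonzero factor det(A)^2 and preserves the
  nucleus plane.\<close>

lemma K_map_only_singular_point:
  fixes A :: "'a::field^3^3"
  assumes two: "(2::'a) = 0" and A: "invertible A" and M: "only_singular_point M W"
  shows "only_singular_point (A ** M ** transpose A) (K_map A W)"
proof -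
  have M': "M \<in> W" "M \<in> nucleus_plane" "M \<noteq> 0"
    and sing: "\<And>N. N \<in> W \<Longrightarrow> det N = 0 \<Longrightarrow> N \<in> mats.span {M}"
    using M unfolding only_singular_point_def by blast+
  have "A ** M ** transpose A \<noteq> A ** 0 ** transpose A"
    using inj_congruence[OF A] M'(3) unfolding inj_def by blast
  then have nz: "A ** M ** transpose A \<noteq> 0"
    by simp
  have "A ** N ** transpose A \<in> mats.span {A ** M ** transpose A}"
    if N: "N \<in> W" "det (A ** N ** transpose A) = 0" for N
  proof -
    have "det A \<noteq> 0"
      using A by (simp add: invertible_det_nz)
    then have "det N = 0"
      using N(2) by (simp add: det_mul)
    then obtain k where "N = mat_scale k M"
      using sing[OF N(1)] by (auto simp: mats.span_singleton)
    then show ?thesis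
      by (simp add: congruence_scale mats.span_scale mats.span_base)
  qed
  then show ?thesis
    using M' nz congruence_nucleus_plane[OF two M'(2), of A]
    by (auto simp: only_singular_point_def K_map_def)
qed

section \<open>The diagonals of the matrices in the plane\<close>

text \<open>Matrices of the nucleus plane are singular, so on \<open>W\<close> the diagonal map has
  the kernel spanned by \<open>M\<close>.\<close>

lemma only_singular_point_zero_diagonal:
  fixes W :: "('a::field^3^3) set"
  assumes "(2::'a) = 0" and "W \<subseteq> sym_mats" and "only_singular_point M W"
    and "N \<in> W" "N$0$0 = 0" "N$1$1 = 0" "N$2$2 = 0"
  shows "N \<in> mats.span {M}"
proof -
  have "N \<in> nucleus_plane"
    using assms by (auto simp: nucleus_plane_iff)
  then show ?thesis
    using assms det_nucleus_plane unfolding only_singular_point_def by blast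
qed

lemma only_singular_point_diagonal_orthogonal:
  fixes W :: "('a::{field,finite}^3^3) set"
  assumes two: "(2::'a) = 0" and W: "W \<in> pg5_subspaces 2" and M: "only_singular_point M W"
    and N: "N \<in> W"
  shows "N$0$0 * (M$1$2)^2 + N$1$1 * (M$0$2)^2 + N$2$2 * (M$0$1)^2 = 0" (is "?s = 0")
proof (rule ccontr)
  assume s: "?s \<noteq> 0"
  have sub: "mats.subspace W" "W \<subseteq> sym_mats"
    using W by (auto simp: pg5_subspaces_def)
  have M': "M \<in> W" "M$0$0 = 0" "M$1$1 = 0" "M$2$2 = 0"
    using M by (auto simp: only_singular_point_def nucleus_plane_iff)
  \<comment> \<open>This \<open>t\<close> is chosen to make \<open>N + t M\<close> singular. That
    matrix is then a multiple of \<open>M\<close>, so \<open>N\<close> has zero diagonal and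
    \<open>?s\<close> vanishes after all.\<close>
  obtain t where t: "det N / ?s = t^2"
    using ex_square_root_char2[OF two] by blast
  let ?N = "N + mat_scale t M"
  have N': "?N \<in> W"
    using sub(1) N M'(1) by (simp add: mats.subspace_add mats.subspace_scale)
  then have "det ?N = det N + t^2 * ?s"
    using N sub(2) M'(2-4) by (simp add: det_sym_char2[OF two] subset_iff algebra_simps
        power2_eq_square char2_simps[OF two])
  also have "\<dots> = 0"
    using s by (simp add: t[symmetric] char2_simps[OF two])
  finally have "?N \<in> mats.span {M}"
    using N' M unfolding only_singular_point_def by blast
  then obtain k where k: "?N = mat_scale k M"
    by (auto simp: mats.span_singleton)
  have "N$i$i = 0" if "M$i$i = 0" for i
    using arg_cong[OF k, of "\<lambda>P. P$i$i"] that by simp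
  then show False
    using s M'(2-4) by simp
qed

lemma card_orthogonal_triples:
  fixes u v w :: "'a::{field,finite}"
  assumes "u \<noteq> 0 \<or> v \<noteq> 0 \<or> w \<noteq> 0"
  shows "card {(x, y, z). x * u + y * v + z * w = 0} = CARD('a)^2"
proof -
  let ?f = "\<lambda>(x, y, z). x * u + y * v + z * w"
  let ?T = "{(x, y, z). x * u + y * v + z * w = 0}"
  have "card (UNIV :: ('a \<times> 'a \<times> 'a) set) = card ?T * card (range ?f)"
    by (rule card_eq_card_kernel_mult_card_image) (auto simp: algebra_simps)
  moreover have "range ?f = UNIV"
  proof (intro equalityI subsetI)
    fix c :: 'a
    have "c = ?f (c / u, 0, 0) \<or> c = ?f (0, c / v, 0) \<or> c = ?f (0, 0, c / w)"
      using assms by auto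
    then show "c \<in> range ?f"
      by (elim disjE) (rule range_eqI, assumption)+
  qed simp
  moreover have "card (UNIV :: ('a \<times> 'a \<times> 'a) set) = CARD('a)^2 * CARD('a)"
    by (simp add: power2_eq_square)
  ultimately show ?thesis
    by simp
qed

lemma card_span_singleton:
  fixes M :: "'a::{field,finite}^'n::finite^'m::finite"
  assumes "M \<noteq> 0" shows "card (mats.span {M}) = CARD('a)"
  using card_span_independent[of "{M}"] assms by simp

text \<open>The diagonal map takes q^3 / q = q^2 values on \<open>W\<close>, all in the orthogonal
  complement of the squared entries of \<open>M\<close>, which has exactly q^2 elements.\<close>

lemma only_singular_point_diagonal_surj:
  fixes W :: "('a::{field,finite}^3^3) set"
  assumes two: "(2::'a) = 0" and W: "W \<in> pg5_subspaces 2" and M: "only_singular_point M W"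
    and x: "x\<^sub>0 * (M$1$2)^2 + x\<^sub>1 * (M$0$2)^2 + x\<^sub>2 * (M$0$1)^2 = 0"
  shows "\<exists>N\<in>W. N$0$0 = x\<^sub>0 \<and> N$1$1 = x\<^sub>1 \<and> N$2$2 = x\<^sub>2"
proof -
  have sub: "mats.subspace W" "W \<subseteq> sym_mats" "mats.dim W = 3"
    using W by (auto simp: pg5_subspaces_def)
  have M': "M \<in> W" "M$0$0 = 0" "M$1$1 = 0" "M$2$2 = 0" "M \<noteq> 0" "M \<in> sym_mats"
    using M by (auto simp: only_singular_point_def nucleus_plane_iff)
  then have u: "(M$1$2)^2 \<noteq> 0 \<or> (M$0$2)^2 \<noteq> 0 \<or> (M$0$1)^2 \<noteq> 0"
    by (auto simp: mat3_eq_iff sym_mats_iff)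
  let ?f = "\<lambda>N::'a^3^3. (N$0$0, N$1$1, N$2$2)"
  let ?T = "{(x, y, z). x * (M$1$2)^2 + y * (M$0$2)^2 + z * (M$0$1)^2 = 0}"
  have MW: "mats.span {M} \<subseteq> W"
    using span_singleton_subset_iff[OF sub(1)] M'(1) by blast
  have "card W = card (mats.span {M}) * card (?f ` W)"
  proof (rule card_eq_card_kernel_mult_card_image)
    show "P + Q \<in> W" if "P \<in> W" "Q \<in> mats.span {M}" for P Q
      using that MW mats.subspace_add[OF sub(1)] by blast
    fix P Q assume PQ: "P \<in> W" "Q \<in> W"
    show "?f P = ?f Q \<longleftrightarrow> Q - P \<in> mats.span {M}"
    proof
      assume "?f P = ?f Q"
      then show "Q - P \<in> mats.span {M}"
        using PQ by (intro only_singular_point_zero_diagonal[OF two sub(2) M])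
          (auto intro: mats.subspace_diff[OF sub(1)])
    next
      assume "Q - P \<in> mats.span {M}"
      then obtain k where k: "Q - P = mat_scale k M"
        by (auto simp: mats.span_singleton)
      have "Q$i$i = P$i$i" if "M$i$i = 0" for i
        using arg_cong[OF k, of "\<lambda>P. P$i$i"] that by simp
      then show "?f P = ?f Q"
        using M' by simp
    qed
  qed simp
  then have "card (?f ` W) = CARD('a)^2"
    using card_subspace[OF sub(1)] sub(3) card_span_singleton[OF M'(5)]
    by (simp add: power2_eq_square power3_eq_cube)
  moreover have "?f ` W \<subseteq> ?T"
    using only_singular_point_diagonal_orthogonal[OF two W M] by auto
  ultimately have "?f ` W = ?T"
    using card_orthogonal_triples[OF u] by (intro card_seteq) auto
  moreover have "(x\<^sub>0, x\<^sub>1, x\<^sub>2) \<in> ?T"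
    using x by simp
  ultimately have "(x\<^sub>0, x\<^sub>1, x\<^sub>2) \<in> ?f ` W"
    by blast
  then show ?thesis
    by auto
qed

subsection \<open>A normal form\<close>

text \<open>The matrix \<open>L\<close> with rows (\<alpha>, \<beta>) and (\<gamma>, \<delta>) sends
  the diagonal entries \<open>N$0$0\<close>, \<open>N$1$1\<close> to the last column; the entry
  \<open>N$0$1\<close> is free and carries the singular point.\<close>

definition normal_plane :: "'a::field \<Rightarrow> 'a \<Rightarrow> 'a \<Rightarrow> 'a \<Rightarrow> ('a^3^3) set" where
  "normal_plane \<alpha> \<beta> \<gamma> \<delta> = {N \<in> sym_mats. N$2$2 = 0 \<and>
     N$0$2 = \<alpha> * N$0$0 + \<beta> * N$1$1 \<and> N$1$2 = \<gamma> * N$0$0 + \<delta> * N$1$1}"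

lemma mat3_in_normal_plane:
  "mat3 x a (\<alpha> * x + \<beta> * y) a y (\<gamma> * x + \<delta> * y) (\<alpha> * x + \<beta> * y) (\<gamma> * x + \<delta> * y) 0
     \<in> normal_plane \<alpha> \<beta> \<gamma> \<delta>"
  by (simp add: normal_plane_def sym_mats_iff)

lemma card_normal_plane: "card (normal_plane \<alpha> \<beta> \<gamma> (\<delta>::'a::{field,finite})) = CARD('a)^3"
proof -
  let ?f = "\<lambda>N::'a^3^3. (N$0$0, N$1$1, N$0$1)"
  have "(x, y, a) \<in> ?f ` normal_plane \<alpha> \<beta> \<gamma> \<delta>" for x y a
    by (rule image_eqI[OF _ mat3_in_normal_plane[of x a \<alpha> \<beta> y \<gamma> \<delta>]]) simp
  then have "?f ` normal_plane \<alpha> \<beta> \<gamma> \<delta> = UNIV"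
    by auto
  moreover have "inj_on ?f (normal_plane \<alpha> \<beta> \<gamma> \<delta>)"
    by (rule inj_onI) (auto simp: normal_plane_def sym_mats_iff mat3_eq_iff)
  ultimately have "card (normal_plane \<alpha> \<beta> \<gamma> \<delta>) = card (UNIV :: ('a \<times> 'a \<times> 'a) set)"
    using card_image[of ?f "normal_plane \<alpha> \<beta> \<gamma> \<delta>"] by simp
  then show ?thesis
    by (simp add: power3_eq_cube)
qed

text \<open>As \<open>N$2$2 = 0\<close>, the determinant is the square of
  \<open>x * N$1$2 + y * N$0$2\<close>.\<close>

lemma det_normal_plane:
  fixes N :: "'a::field^3^3"
  assumes two: "(2::'a) = 0" and N: "N \<in> normal_plane \<alpha> \<beta> \<gamma> \<delta>" and sq: "N$0$0 = x^2" "N$1$1 = y^2"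
  shows "det N = (binary_cubic \<gamma> \<alpha> \<delta> \<beta> x y)^2"
  using N by (simp add: det_sym_char2[OF two] normal_plane_def sq binary_cubic_def algebra_simps
      power2_eq_square power3_eq_cube char2_simps[OF two])

lemma normal_plane_pg5_subspaces:
  "normal_plane \<alpha> \<beta> \<gamma> (\<delta>::'a::{field,finite}) \<in> pg5_subspaces 2"
proof -
  have sub: "mats.subspace (normal_plane \<alpha> \<beta> \<gamma> \<delta>)"
    by (auto simp: mats.subspace_def normal_plane_def sym_mats_iff algebra_simps)
  then have "CARD('a) ^ mats.dim (normal_plane \<alpha> \<beta> \<gamma> \<delta>) = CARD('a) ^ 3"
    using card_subspace[OF sub] card_normal_plane[of \<alpha> \<beta> \<gamma> \<delta>] by simp
  then have "mats.dim (normal_plane \<alpha> \<beta> \<gamma> \<delta>) = 3"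
    using card_field_gt_1[where 'a = 'a] power_inject_exp by blast
  then show ?thesis
    using sub by (auto simp: pg5_subspaces_def normal_plane_def)
qed

lemma normal_plane_only_singular_point:
  fixes \<alpha> \<beta> \<gamma> \<delta> :: "'a::{field,finite}"
  assumes two: "(2::'a) = 0" and an: "anisotropic \<gamma> \<alpha> \<delta> \<beta>"
  shows "only_singular_point (mat3 0 1 0 1 0 0 0 0 0) (normal_plane \<alpha> \<beta> \<gamma> \<delta>)"
proof -
  let ?M = "mat3 0 1 0 1 0 0 0 0 (0::'a)"
  have "N \<in> mats.span {?M}" if N: "N \<in> normal_plane \<alpha> \<beta> \<gamma> \<delta>" "det N = 0" for N
  proof -
    obtain x y where sq: "N$0$0 = x^2" "N$1$1 = y^2"
      using ex_square_root_char2[OF two] by metis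
    then have "binary_cubic \<gamma> \<alpha> \<delta> \<beta> x y = 0"
      using det_normal_plane[OF two N(1) sq] N(2) by simp
    then have "x = 0" "y = 0"
      using an unfolding anisotropic_def by blast+
    then have "N = mat_scale (N$0$1) ?M"
      using N(1) sq by (simp add: normal_plane_def sym_mats_iff mat3_eq_iff)
    then show ?thesis
      unfolding mats.span_singleton by blast
  qed
  then show ?thesis
    by (auto simp: only_singular_point_def normal_plane_def nucleus_plane_iff sym_mats_iff mat3_eq_iff)
qed

text \<open>Here the diagonals of \<open>W\<close> are those with last entry 0. Matrices of
  \<open>W\<close> with the diagonals (1,0,0) and (0,1,0) span \<open>W\<close> together with
  \<open>M\<close>, and their last columns are the columns of \<open>L\<close>. A zero of the cubic
  gives a singular matrix of \<open>W\<close>, hence a multiple of \<open>M\<close>, with zero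
  diagonal.\<close>

lemma only_singular_point_normal_form:
  fixes W :: "('a::{field,finite}^3^3) set"
  assumes two: "(2::'a) = 0" and W: "W \<in> pg5_subspaces 2" and M: "only_singular_point M W"
    and u: "M$0$2 = 0" "M$1$2 = 0"
  shows "\<exists>\<alpha> \<beta> \<gamma> \<delta>. anisotropic \<gamma> \<alpha> \<delta> \<beta> \<and> W = normal_plane \<alpha> \<beta> \<gamma> \<delta>"
proof -
  have sub: "mats.subspace W" "W \<subseteq> sym_mats" "mats.dim W = 3"
    using W by (auto simp: pg5_subspaces_def)
  have M': "M \<in> W" "M$0$0 = 0" "M$1$1 = 0" "M$2$2 = 0" "M \<noteq> 0" "M \<in> sym_mats"
    using M by (auto simp: only_singular_point_def nucleus_plane_iff)
  then have u2: "M$0$1 \<noteq> 0"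
    using u by (auto simp: mat3_eq_iff sym_mats_iff)
  obtain N\<^sub>1 where N1: "N\<^sub>1 \<in> W" "N\<^sub>1$0$0 = 1" "N\<^sub>1$1$1 = 0" "N\<^sub>1$2$2 = 0"
    using only_singular_point_diagonal_surj[OF two W M, of 1 0 0] u by auto
  obtain N\<^sub>2 where N2: "N\<^sub>2 \<in> W" "N\<^sub>2$0$0 = 0" "N\<^sub>2$1$1 = 1" "N\<^sub>2$2$2 = 0"
    using only_singular_point_diagonal_surj[OF two W M, of 0 1 0] u by auto
  define \<alpha> \<beta> \<gamma> \<delta> where "\<alpha> = N\<^sub>1$0$2" "\<beta> = N\<^sub>2$0$2" "\<gamma> = N\<^sub>1$1$2" "\<delta> = N\<^sub>2$1$2"
  note defs = this
  have "W \<subseteq> normal_plane \<alpha> \<beta> \<gamma> \<delta>"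
  proof
    fix N assume N: "N \<in> W"
    have N22: "N$2$2 = 0"
      using only_singular_point_diagonal_orthogonal[OF two W M N] u u2 by simp
    have "N - mat_scale (N$0$0) N\<^sub>1 - mat_scale (N$1$1) N\<^sub>2 \<in> mats.span {M}"
      using N N1 N2 N22 by (intro only_singular_point_zero_diagonal[OF two sub(2) M])
        (auto intro!: mats.subspace_diff[OF sub(1)] mats.subspace_scale[OF sub(1)])
    then obtain k where k: "N - mat_scale (N$0$0) N\<^sub>1 - mat_scale (N$1$1) N\<^sub>2 = mat_scale k M"
      by (auto simp: mats.span_singleton)
    have "N$0$2 = \<alpha> * N$0$0 + \<beta> * N$1$1" "N$1$2 = \<gamma> * N$0$0 + \<delta> * N$1$1"
      using arg_cong[OF k, of "\<lambda>P. P$0$2"] arg_cong[OF k, of "\<lambda>P. P$1$2"] u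
      by (simp_all add: defs algebra_simps)
    then show "N \<in> normal_plane \<alpha> \<beta> \<gamma> \<delta>"
      using N sub(2) N22 by (auto simp: normal_plane_def)
  qed
  then have Weq: "W = normal_plane \<alpha> \<beta> \<gamma> \<delta>"
    using card_subspace[OF sub(1)] sub(3) by (intro card_seteq) (auto simp: card_normal_plane)
  have "x = 0 \<and> y = 0" if xy: "binary_cubic \<gamma> \<alpha> \<delta> \<beta> x y = 0" for x y
  proof -
    obtain N where N: "N \<in> W" "N$0$0 = x^2" "N$1$1 = y^2"
      using mat3_in_normal_plane[of "x^2" 0 \<alpha> \<beta> "y^2" \<gamma> \<delta>] unfolding Weq by (metis mat3_nth(1,5))
    then have "det N = 0"
      using det_normal_plane[OF two _ N(2,3)] xy unfolding Weq by simp
    then have "N \<in> mats.span {M}"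
      using N(1) M unfolding only_singular_point_def by blast
    then obtain k where "N = mat_scale k M"
      by (auto simp: mats.span_singleton)
    then show ?thesis
      using N(2,3) M'(2,3) by auto
  qed
  then have "anisotropic \<gamma> \<alpha> \<delta> \<beta>"
    unfolding anisotropic_def by blast
  then show ?thesis
    using Weq by blast
qed

section \<open>Reduction to the normal form and equivalence of normal forms\<close>

lemma ex_invertible_last_row:
  fixes u v w :: "'a::field"
  assumes "u \<noteq> 0 \<or> v \<noteq> 0 \<or> w \<noteq> 0"
  shows "\<exists>A::'a^3^3. invertible A \<and> A$2$0 = u \<and> A$2$1 = v \<and> A$2$2 = w"
proof -
  consider "u \<noteq> 0" | "v \<noteq> 0" | "w \<noteq> 0"
    using assms by blast
  then show ?thesis
  proof cases
    case 1
    then show ?thesis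
      by (intro exI[of _ "mat3 0 1 0 0 0 1 u v w"]) (simp add: invertible_det_nz det_3')
  next
    case 2
    then show ?thesis
      by (intro exI[of _ "mat3 1 0 0 0 0 1 u v w"]) (simp add: invertible_det_nz det_3')
  next
    case 3
    then show ?thesis
      by (intro exI[of _ "mat3 1 0 0 0 1 0 u v w"]) (simp add: invertible_det_nz det_3')
  qed
qed

lemma K_map_to_normal_plane:
  fixes W :: "('a::{field,finite}^3^3) set"
  assumes two: "(2::'a) = 0" and W: "W \<in> pg5_subspaces 2" and M: "only_singular_point M W"
  shows "\<exists>A \<alpha> \<beta> \<gamma> \<delta>. invertible A \<and> anisotropic \<gamma> \<alpha> \<delta> \<beta> \<and> K_map A W = normal_plane \<alpha> \<beta> \<gamma> \<delta>"
proof -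
  have M': "M$0$0 = 0" "M$1$1 = 0" "M$2$2 = 0" "M \<noteq> 0" "M$1$0 = M$0$1" "M$2$0 = M$0$2" "M$2$1 = M$1$2"
    using M by (auto simp: only_singular_point_def nucleus_plane_iff sym_mats_iff)
  then have "M$1$2 \<noteq> 0 \<or> M$0$2 \<noteq> 0 \<or> M$0$1 \<noteq> 0"
    by (auto simp: mat3_eq_iff)
  then obtain A :: "'a^3^3" where A: "invertible A" "A$2$0 = M$1$2" "A$2$1 = M$0$2" "A$2$2 = M$0$1"
    using ex_invertible_last_row by blast
  \<comment> \<open>The last row of \<open>A\<close> spans the kernel of \<open>M\<close>.\<close>
  have "(A ** M ** transpose A)$0$2 = 0" "(A ** M ** transpose A)$1$2 = 0"
    by (simp_all add: mult3_nth transpose_nth A M' algebra_simps char2_simps[OF two])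
  then show ?thesis
    using only_singular_point_normal_form[OF two K_map_pg5_subspaces[OF A(1) W]
        K_map_only_singular_point[OF two A(1) M]] A(1) by blast
qed

text \<open>The block diagonal matrix with blocks B and \<open>s\<close> acts on the diagonal (N00,
  N11) by the entrywise square of B and on the last column (N02, N12) by \<open>s B\<close>. The
  relation between the cubics therefore says that one plane is mapped into the other, and the
  cardinalities agree.\<close>

lemma normal_planes_equivalent:
  fixes \<alpha> \<beta> \<gamma> \<delta> \<alpha>' \<beta>' \<gamma>' \<delta>' :: "'a::{field,finite}"
  assumes two: "(2::'a) = 0"
    and an: "anisotropic \<gamma> \<alpha> \<delta> \<beta>" and an': "anisotropic \<gamma>' \<alpha>' \<delta>' \<beta>'"
  shows "\<exists>A. invertible A \<and> K_map A (normal_plane \<alpha> \<beta> \<gamma> \<delta>) = normal_plane \<alpha>' \<beta>' \<gamma>' \<delta>'"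
proof -
  obtain a b c d s where s: "s \<noteq> 0" "a * d - b * c \<noteq> 0"
    and eq: "s * (a * \<alpha> + b * \<gamma>) = \<alpha>' * a^2 + \<beta>' * c^2" "s * (a * \<beta> + b * \<delta>) = \<alpha>' * b^2 + \<beta>' * d^2"
      "s * (c * \<alpha> + d * \<gamma>) = \<gamma>' * a^2 + \<delta>' * c^2" "s * (c * \<beta> + d * \<delta>) = \<gamma>' * b^2 + \<delta>' * d^2"
    using anisotropic_cubics_equivalent[OF two an an'] by blast
  define A where "A = mat3 a b 0 c d 0 0 0 s"
  have "det A = s * (a * d - b * c)"
    by (simp add: A_def det_3' algebra_simps)
  then have A: "invertible A"
    using s by (simp add: invertible_det_nz)
  have "A ** N ** transpose A \<in> normal_plane \<alpha>' \<beta>' \<gamma>' \<delta>'" if N: "N \<in> normal_plane \<alpha> \<beta> \<gamma> \<delta>" for N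
  proof -
    let ?N = "A ** N ** transpose A"
    have N': "N$1$0 = N$0$1" "N$2$0 = N$0$2" "N$2$1 = N$1$2" "N$2$2 = 0"
        "N$0$2 = \<alpha> * N$0$0 + \<beta> * N$1$1" "N$1$2 = \<gamma> * N$0$0 + \<delta> * N$1$1"
      using N by (auto simp: normal_plane_def sym_mats_iff)
    have d: "?N$0$0 = a^2 * N$0$0 + b^2 * N$1$1" "?N$1$1 = c^2 * N$0$0 + d^2 * N$1$1"
      by (simp_all add: A_def mult3_nth transpose_nth N'(1) algebra_simps power2_eq_square char2_simps[OF two])
    have "?N$0$2 = s * (a * \<alpha> + b * \<gamma>) * N$0$0 + s * (a * \<beta> + b * \<delta>) * N$1$1"
      by (simp add: A_def mult3_nth transpose_nth N' algebra_simps)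
    also have "\<dots> = \<alpha>' * ?N$0$0 + \<beta>' * ?N$1$1"
      unfolding eq d by (simp add: algebra_simps)
    finally have 02: "?N$0$2 = \<alpha>' * ?N$0$0 + \<beta>' * ?N$1$1" .
    have "?N$1$2 = s * (c * \<alpha> + d * \<gamma>) * N$0$0 + s * (c * \<beta> + d * \<delta>) * N$1$1"
      by (simp add: A_def mult3_nth transpose_nth N' algebra_simps)
    also have "\<dots> = \<gamma>' * ?N$0$0 + \<delta>' * ?N$1$1"
      unfolding eq d by (simp add: algebra_simps)
    finally have 12: "?N$1$2 = \<gamma>' * ?N$0$0 + \<delta>' * ?N$1$1" .
    have "?N$2$2 = 0"
      by (simp add: A_def mult3_nth transpose_nth N'(4))
    moreover have "?N \<in> sym_mats"
      using N by (intro congruence_sym_mats) (simp add: normal_plane_def)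
    ultimately show ?thesis
      using 02 12 by (simp add: normal_plane_def)
  qed
  then have "K_map A (normal_plane \<alpha> \<beta> \<gamma> \<delta>) \<subseteq> normal_plane \<alpha>' \<beta>' \<gamma>' \<delta>'"
    by (auto simp: K_map_def)
  then have "K_map A (normal_plane \<alpha> \<beta> \<gamma> \<delta>) = normal_plane \<alpha>' \<beta>' \<gamma>' \<delta>'"
    using card_K_map[OF A] by (intro card_seteq) (auto simp: card_normal_plane)
  then show ?thesis
    using A by blast
qed

subsection \<open>Conics and hyperplanes\<close>

definition pairing :: "'a::field^3^3 \<Rightarrow> 'a^3^3 \<Rightarrow> 'a" where
  "pairing a N = a$0$0 * N$0$0 + a$0$1 * N$0$1 + a$0$2 * N$0$2 + a$1$1 * N$1$1 + a$1$2 * N$1$2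
     + a$2$2 * N$2$2"

text \<open>The quadratic forms with zero included, so that they make up a vector space.\<close>

definition upper_mats :: "('a::field^3^3) set" where
  "upper_mats = {a. a$1$0 = 0 \<and> a$2$0 = 0 \<and> a$2$1 = 0}"

definition annihilator :: "('a::field^3^3) set \<Rightarrow> ('a^3^3) set" where
  "annihilator W = {a \<in> upper_mats. \<forall>N\<in>W. pairing a N = 0}"

text \<open>In characteristic 2 this says that the nucleus vanishes; over a finite field the form is
  then the square of a linear form.\<close>

definition off_diagonal_zero :: "'a::field^3^3 \<Rightarrow> bool" where
  "off_diagonal_zero a \<longleftrightarrow> a$0$1 = 0 \<and> a$0$2 = 0 \<and> a$1$2 = 0"

text \<open>In characteristic 2 this is the value of the conic at its nucleus \<open>(a\<^sub>1\<^sub>2, a\<^sub>0\<^sub>2, a\<^sub>0\<^sub>1)\<close>.\<close>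

definition half_discriminant :: "'a::field^3^3 \<Rightarrow> 'a" where
  "half_discriminant a = a$0$0 * (a$1$2)^2 + a$1$1 * (a$0$2)^2 + a$2$2 * (a$0$1)^2
     + a$0$1 * a$0$2 * a$1$2"

lemma pairing_add: "pairing (a + b) N = pairing a N + pairing b N" "pairing a (N + P) = pairing a N + pairing a P"
  and pairing_diff: "pairing (a - b) N = pairing a N - pairing b N" "pairing a (N - P) = pairing a N - pairing a P"
  and pairing_scale: "pairing (mat_scale c a) N = c * pairing a N" "pairing a (mat_scale c N) = c * pairing a N"
  by (simp_all add: pairing_def algebra_simps)

lemma not_less_3 [simp]: "\<not> (1::3) < 0" "\<not> (2::3) < 0" "\<not> (2::3) < 1"
  using less_3 by (meson order.asym)+

lemma quadratic_forms_eq: "quadratic_forms = upper_mats - {0}"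
  by (auto simp: quadratic_forms_def upper_mats_def all_3)

lemma hyperplane_of_eq: "hyperplane_of a = {N \<in> sym_mats. pairing a N = 0}"
  by (simp add: hyperplane_of_def pairing_def sum_3' atLeast_3 add_ac)

lemma qf_eval_3: "qf_eval a x = a$0$0 * x$0 * x$0 + a$0$1 * x$0 * x$1 + a$0$2 * x$0 * x$2
    + a$1$1 * x$1 * x$1 + a$1$2 * x$1 * x$2 + a$2$2 * x$2 * x$2"
  by (simp add: qf_eval_def sum_3' atLeast_3 add_ac)

lemma qf_partial_3:
  "qf_partial a 0 x = a$0$0 * (x$0 + x$0) + a$0$1 * x$1 + a$0$2 * x$2"
  "qf_partial a 1 x = a$0$1 * x$0 + a$1$1 * (x$1 + x$1) + a$1$2 * x$2"
  "qf_partial a 2 x = a$0$2 * x$0 + a$1$2 * x$1 + a$2$2 * (x$2 + x$2)"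
  by (simp_all add: qf_partial_def sum_3' atLeast_3 add_ac)

lemma subspace_upper_mats: "mats.subspace upper_mats"
  by (auto simp: mats.subspace_def upper_mats_def)

lemma subspace_annihilator: "mats.subspace (annihilator W)"
  using subspace_upper_mats
  by (auto simp: mats.subspace_def annihilator_def pairing_add pairing_scale) (simp add: pairing_def)

lemma subset_hyperplane_of_iff:
  assumes "W \<subseteq> sym_mats" "a \<in> upper_mats"
  shows "W \<subseteq> hyperplane_of a \<longleftrightarrow> a \<in> annihilator W"
  using assms by (auto simp: hyperplane_of_eq annihilator_def)

lemma upper_mats_eqI:
  assumes "a \<in> upper_mats" "b \<in> upper_mats" "\<And>N. N \<in> sym_mats \<Longrightarrow> pairing a N = pairing b N"
  shows "a = b"
  using assms(1,2) assms(3)[of "mat3 1 0 0 0 0 0 0 0 0"] assms(3)[of "mat3 0 0 0 0 1 0 0 0 0"]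
    assms(3)[of "mat3 0 0 0 0 0 0 0 0 1"] assms(3)[of "mat3 0 1 0 1 0 0 0 0 0"]
    assms(3)[of "mat3 0 0 1 0 0 0 1 0 0"] assms(3)[of "mat3 0 0 0 0 0 1 0 1 0"]
  by (simp add: sym_mats_iff pairing_def upper_mats_def mat3_eq_iff)

text \<open>Linear forms with the same kernel are proportional; the factor is found at a matrix
  \<open>P\<close> outside the kernel.\<close>

lemma hyperplane_of_eq_iff:
  assumes a: "a \<in> upper_mats" "a \<noteq> 0" and b: "b \<in> upper_mats" "b \<noteq> 0"
  shows "hyperplane_of a = hyperplane_of b \<longleftrightarrow> (\<exists>k. k \<noteq> 0 \<and> b = mat_scale k a)"
proof
  assume eq: "hyperplane_of a = hyperplane_of b"
  obtain P where P: "P \<in> sym_mats" "pairing a P \<noteq> 0"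
    using upper_mats_eqI[OF a(1), of 0] a(2) by (auto simp: upper_mats_def pairing_def)
  define k where "k = pairing b P / pairing a P"
  have "pairing b N = pairing (mat_scale k a) N" if N: "N \<in> sym_mats" for N
  proof -
    let ?N = "mat_scale (pairing a P) N - mat_scale (pairing a N) P"
    have "?N \<in> hyperplane_of a"
      using N P(1) by (simp add: hyperplane_of_eq pairing_diff pairing_scale
          mats.subspace_diff[OF subspace_sym_mats] mats.subspace_scale[OF subspace_sym_mats])
    then have "pairing b ?N = 0"
      unfolding eq by (simp add: hyperplane_of_eq)
    then show ?thesis
      using P(2) by (simp add: k_def pairing_diff pairing_scale field_simps)
  qed
  then have "b = mat_scale k a"
    using a(1) b(1) by (intro upper_mats_eqI) (auto simp: mats.subspace_scale[OF subspace_upper_mats])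
  then show "\<exists>k. k \<noteq> 0 \<and> b = mat_scale k a"
    using b(2) by auto
next
  assume "\<exists>k. k \<noteq> 0 \<and> b = mat_scale k a"
  then show "hyperplane_of a = hyperplane_of b"
    by (auto simp: hyperplane_of_eq pairing_scale)
qed

lemma card_upper_mats: "card (upper_mats :: ('a::{field,finite}^3^3) set) = CARD('a)^6"
proof -
  let ?f = "\<lambda>(a, b, c, d, e, f). mat3 a b c 0 d e 0 0 (f::'a)"
  have "inj ?f"
    by (rule injI) (auto simp: mat3_eq_iff)
  then have "card (range ?f) = CARD('a)^6"
    by (subst card_image) (simp_all add: numeral_eq_Suc)
  moreover have "a \<in> range ?f" if "a \<in> upper_mats" for a
    using that by (intro range_eqI[of _ _ "(a$0$0, a$0$1, a$0$2, a$1$1, a$1$2, a$2$2)"])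
      (auto simp: upper_mats_def mat3_eq_iff)
  then have "upper_mats = range ?f"
    by (auto simp: upper_mats_def)
  ultimately show ?thesis
    by simp
qed

text \<open>Evaluation on a basis of \<open>W\<close> sends q^6 forms to at most q^3 triples of
  values, and its kernel is the annihilator.\<close>

lemma card_annihilator_ge:
  fixes W :: "('a::{field,finite}^3^3) set"
  assumes "mats.dim W = 3"
  shows "CARD('a)^3 \<le> card (annihilator W)"
proof -
  obtain B where B: "B \<subseteq> W" "mats.independent B" "W \<subseteq> mats.span B" "card B = mats.dim W"
    using mats.basis_exists[of W] by blast
  let ?f = "\<lambda>a. \<lambda>b\<in>B. pairing a b"
  have span: "a \<in> annihilator W" if "a \<in> annihilator B" for a
  proof -
    have "mats.subspace {N. pairing a N = 0}"
      by (auto simp: mats.subspace_def pairing_add pairing_scale) (simp add: pairing_def)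
    moreover have "B \<subseteq> {N. pairing a N = 0}"
      using that by (auto simp: annihilator_def)
    ultimately have "W \<subseteq> {N. pairing a N = 0}"
      using B(3) mats.span_minimal by blast
    then show ?thesis
      using that by (auto simp: annihilator_def)
  qed
  have ann: "annihilator W = annihilator B"
    using span B(1) by (auto simp: annihilator_def)
  have "card (upper_mats :: ('a^3^3) set) = card (annihilator B) * card (?f ` upper_mats)"
  proof (rule card_eq_card_kernel_mult_card_image)
    fix a b :: "'a^3^3" assume ab: "a \<in> upper_mats" "b \<in> upper_mats"
    have "?f a = ?f b \<longleftrightarrow> (\<forall>N\<in>B. pairing a N = pairing b N)"
      by (auto simp: fun_eq_iff restrict_def)
    then show "?f a = ?f b \<longleftrightarrow> b - a \<in> annihilator B"
      using ab by (auto simp: annihilator_def pairing_diff mats.subspace_diff[OF subspace_upper_mats])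
  qed (auto simp: annihilator_def mats.subspace_add[OF subspace_upper_mats])
  moreover have "card (?f ` upper_mats) \<le> card (B \<rightarrow>\<^sub>E (UNIV :: 'a set))"
    by (intro card_mono) (auto intro!: finite_PiE)
  moreover have "card (B \<rightarrow>\<^sub>E (UNIV :: 'a set)) = CARD('a)^3"
    using B(4) assms by (simp add: card_PiE)
  ultimately have "CARD('a)^6 \<le> card (annihilator W) * CARD('a)^3"
    unfolding ann by (metis card_upper_mats mult_le_mono2)
  then have "CARD('a)^3 * CARD('a)^3 \<le> card (annihilator W) * CARD('a)^3"
    by (simp flip: power_add)
  then show ?thesis
    by (metis mult_le_cancel2 zero_less_card_finite zero_less_power)
qed

subsection \<open>Conics containing a plane with a single singular point\<close>

text \<open>In characteristic 2 this is the square of the linear form with the coefficients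
  \<open>M$1$2\<close>, \<open>M$0$2\<close>, \<open>M$0$1\<close>.\<close>

abbreviation nucleus_line :: "'a::field^3^3 \<Rightarrow> 'a^3^3" where
  "nucleus_line M \<equiv> mat3 ((M$1$2)^2) 0 0 0 ((M$0$2)^2) 0 0 0 ((M$0$1)^2)"

text \<open>A diagonal form only sees the diagonals of \<open>W\<close>. These fill the orthogonal
  complement of the vector of squared entries of \<open>M\<close>, so the form is a multiple of that
  vector.\<close>

lemma annihilator_diagonal_iff:
  fixes W :: "('a::{field,finite}^3^3) set"
  assumes two: "(2::'a) = 0" and W: "W \<in> pg5_subspaces 2" and M: "only_singular_point M W"
  shows "a \<in> annihilator W \<and> off_diagonal_zero a \<longleftrightarrow> a \<in> mats.span {nucleus_line M}"
proof
  have M': "M \<noteq> 0" "M \<in> nucleus_plane"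
    using M by (auto simp: only_singular_point_def)
  then have u: "(M$1$2)^2 \<noteq> 0 \<or> (M$0$2)^2 \<noteq> 0 \<or> (M$0$1)^2 \<noteq> 0"
    by (auto simp: mat3_eq_iff sym_mats_iff nucleus_plane_iff)
  note surj = only_singular_point_diagonal_surj[OF two W M]
  {
    assume a: "a \<in> annihilator W \<and> off_diagonal_zero a"
    define u v w where uvw: "u = (M$1$2)^2" "v = (M$0$2)^2" "w = (M$0$1)^2"
    have orth: "a$0$0 * x + a$1$1 * y + a$2$2 * z = 0" if orth: "x * u + y * v + z * w = 0" for x y z
    proof -
      obtain N where "N \<in> W" "N$0$0 = x" "N$1$1 = y" "N$2$2 = z"
        using surj[of x y z] orth unfolding uvw by blast
      then show ?thesis
        using a by (auto simp: annihilator_def pairing_def off_diagonal_zero_def)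
    qed
    \<comment> \<open>The triples \<open>(v, - u, 0)\<close>, \<open>(w, 0, - u)\<close>,
      \<open>(0, w, - v)\<close> are orthogonal to \<open>(u, v, w)\<close> and hence occur as
      diagonals.\<close>
    have cross: "a$0$0 * v = a$1$1 * u" "a$0$0 * w = a$2$2 * u" "a$1$1 * w = a$2$2 * v"
      using orth[of v "- u" 0] orth[of w 0 "- u"] orth[of 0 w "- v"] by (simp_all add: algebra_simps)
    obtain k where k: "a$0$0 = k * u" "a$1$1 = k * v" "a$2$2 = k * w"
    proof -
      consider "u \<noteq> 0" | "v \<noteq> 0" | "w \<noteq> 0"
        using u uvw by auto
      then show ?thesis
      proof cases
        case 1
        then show ?thesis
          using cross by (intro that[of "a$0$0 / u"]) (auto simp: field_simps)
      next
        case 2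
        then show ?thesis
          using cross by (intro that[of "a$1$1 / v"]) (auto simp: field_simps)
      next
        case 3
        then show ?thesis
          using cross by (intro that[of "a$2$2 / w"]) (auto simp: field_simps)
      qed
    qed
    have "a = mat_scale k (nucleus_line M)"
      using a k by (simp add: mat3_eq_iff annihilator_def upper_mats_def off_diagonal_zero_def uvw)
    then show "a \<in> mats.span {nucleus_line M}"
      by (auto simp: mats.span_singleton)
  }
  assume "a \<in> mats.span {nucleus_line M}"
  then obtain k where k: "a = mat_scale k (nucleus_line M)"
    by (auto simp: mats.span_singleton)
  have "pairing (nucleus_line M) N = 0" if "N \<in> W" for N
    using only_singular_point_diagonal_orthogonal[OF two W M that] by (simp add: pairing_def mult.commute)
  then show "a \<in> annihilator W \<and> off_diagonal_zero a"
    by (simp add: k annihilator_def pairing_scale) (simp add: upper_mats_def off_diagonal_zero_def)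
qed

lemma nucleus_line_nonzero: "M \<in> nucleus_plane \<Longrightarrow> M \<noteq> 0 \<Longrightarrow> nucleus_line M \<noteq> 0"
  by (auto simp: mat3_eq_iff sym_mats_iff nucleus_plane_iff)

text \<open>For the upper bound, the form is sent to its nucleus: the kernel is the span of the
  double line, with q elements, and pairing with \<open>M\<close> confines the nuclei to q^2
  values.\<close>

lemma card_annihilator:
  fixes W :: "('a::{field,finite}^3^3) set"
  assumes two: "(2::'a) = 0" and W: "W \<in> pg5_subspaces 2" and M: "only_singular_point M W"
  shows "card (annihilator W) = CARD('a)^3"
proof (rule antisym)
  have M': "M \<noteq> 0" "M \<in> nucleus_plane" "M \<in> W"
    using M by (auto simp: only_singular_point_def)
  let ?f = "\<lambda>a::'a^3^3. (a$1$2, a$0$2, a$0$1)"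
  let ?T = "{(x, y, z). x * M$1$2 + y * M$0$2 + z * M$0$1 = 0}"
  have diag: "a \<in> mats.span {nucleus_line M} \<longleftrightarrow> a \<in> annihilator W \<and> off_diagonal_zero a" for a
    using annihilator_diagonal_iff[OF two W M] by blast
  have "card (annihilator W) = card (mats.span {nucleus_line M}) * card (?f ` annihilator W)"
  proof (rule card_eq_card_kernel_mult_card_image)
    show "a + b \<in> annihilator W" if "a \<in> annihilator W" "b \<in> mats.span {nucleus_line M}" for a b
      using that by (simp add: diag mats.subspace_add[OF subspace_annihilator])
    show "?f a = ?f b \<longleftrightarrow> b - a \<in> mats.span {nucleus_line M}"
      if "a \<in> annihilator W" "b \<in> annihilator W" for a b
      using that by (auto simp: diag off_diagonal_zero_def mats.subspace_diff[OF subspace_annihilator])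
  qed simp
  also have "card (mats.span {nucleus_line M}) = CARD('a)"
    using nucleus_line_nonzero M' by (intro card_span_singleton) auto
  also have "card (?f ` annihilator W) \<le> card ?T"
  proof (rule card_mono)
    show "?f ` annihilator W \<subseteq> ?T"
    proof clarsimp
      fix a assume "a \<in> annihilator W"
      then have "pairing a M = 0"
        using M'(3) by (simp add: annihilator_def)
      then show "a$1$2 * M$1$2 + a$0$2 * M$0$2 + a$0$1 * M$0$1 = 0"
        using M'(2) by (simp add: pairing_def nucleus_plane_iff algebra_simps)
    qed
  qed simp
  also have "card ?T = CARD('a)^2"
    using M' by (intro card_orthogonal_triples) (auto simp: mat3_eq_iff sym_mats_iff nucleus_plane_iff)
  finally show "card (annihilator W) \<le> CARD('a)^3"
    by (simp add: power2_eq_square power3_eq_cube)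
  show "CARD('a)^3 \<le> card (annihilator W)"
    using W by (intro card_annihilator_ge) (simp add: pg5_subspaces_def)
qed

text \<open>
  If the nucleus \<open>p\<close> of \<open>a\<close> is nonzero, some \<open>N \<in> W\<close> has the diagonal \<open>p\<^sup>2\<close>, and then
  \<open>pairing a N = 0\<close> turns \<open>det N\<close> into the square of the half-discriminant of \<open>a\<close>.
\<close>

lemma annihilator_half_discriminant:
  fixes W :: "('a::{field,finite}^3^3) set"
  assumes two: "(2::'a) = 0" and W: "W \<in> pg5_subspaces 2" and M: "only_singular_point M W"
    and a: "a \<in> annihilator W" "\<not> off_diagonal_zero a"
  shows "half_discriminant a \<noteq> 0"
proof
  assume 0: "half_discriminant a = 0"
  note ch = char2_simps[OF two]
  have M': "M \<noteq> 0" "M \<in> nucleus_plane" "M \<in> W"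
    using M by (auto simp: only_singular_point_def)
  have "pairing a M = 0"
    using a(1) M'(3) by (simp add: annihilator_def)
  then have pu: "a$1$2 * M$1$2 + a$0$2 * M$0$2 + a$0$1 * M$0$1 = 0"
    using M'(2) by (simp add: pairing_def nucleus_plane_iff algebra_simps)
  \<comment> \<open>Squaring is additive, so orthogonality of the nucleus to \<open>M\<close> passes
    to the squares, which therefore form a diagonal of \<open>W\<close>.\<close>
  have "(a$1$2)^2 * (M$1$2)^2 + (a$0$2)^2 * (M$0$2)^2 + (a$0$1)^2 * (M$0$1)^2
      = (a$1$2 * M$1$2 + a$0$2 * M$0$2 + a$0$1 * M$0$1)^2"
    by (simp add: power2_eq_square algebra_simps ch)
  then obtain N where N: "N \<in> W" "N$0$0 = (a$1$2)^2" "N$1$1 = (a$0$2)^2" "N$2$2 = (a$0$1)^2"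
    using only_singular_point_diagonal_surj[OF two W M] pu by (metis zero_power2)
  have sym: "N \<in> sym_mats"
    using N(1) W by (auto simp: pg5_subspaces_def)
  have "det N = (a$1$2 * a$0$2 * a$0$1 + a$1$2 * N$1$2 + a$0$2 * N$0$2 + a$0$1 * N$0$1)^2"
    by (simp add: det_sym_char2[OF two sym] N power2_eq_square algebra_simps ch)
  also have "a$1$2 * a$0$2 * a$0$1 + a$1$2 * N$1$2 + a$0$2 * N$0$2 + a$0$1 * N$0$1
      = half_discriminant a + pairing a N"
    by (simp add: half_discriminant_def pairing_def N algebra_simps ch)
  also have "\<dots> = 0"
    using 0 a(1) N(1) by (simp add: annihilator_def)
  finally have "N \<in> mats.span {M}"
    using N(1) M by (simp add: only_singular_point_def)
  then obtain k where "N = mat_scale k M"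
    by (auto simp: mats.span_singleton)
  then have "off_diagonal_zero a"
    using N M'(2) by (auto simp: off_diagonal_zero_def nucleus_plane_iff)
  then show False
    using a(2) by blast
qed

section \<open>Types of conics in characteristic two\<close>

text \<open>The mixed terms of a square occur twice and cancel; conversely, square roots of the
  diagonal coefficients give the line.\<close>

lemma double_line_iff:
  fixes a :: "'a::{field,finite}^3^3"
  assumes two: "(2::'a) = 0" and a: "a \<in> upper_mats" "a \<noteq> 0"
  shows "double_line a \<longleftrightarrow> off_diagonal_zero a"
proof
  assume "double_line a"
  then show "off_diagonal_zero a"
    by (auto simp: double_line_def line_product_def off_diagonal_zero_def mult.commute
        char2_simps[OF two])
next
  assume off: "off_diagonal_zero a"
  obtain f where f: "\<And>x::'a. x = (f x)^2"
    using ex_square_root_char2[OF two] by metis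
  define l :: "'a^3" where "l = (\<chi> i. f (a$i$i))"
  have eq: "a = mat_scale 1 (line_product l l)"
    using a(1) off f by (simp add: mat3_eq_iff l_def line_product_def upper_mats_def
        off_diagonal_zero_def char2_simps[OF two] mult.commute flip: power2_eq_square)
  moreover have "l \<noteq> 0"
    using eq a(2) by (auto simp: line_product_def mat3_eq_iff)
  ultimately show "double_line a"
    unfolding double_line_def by (metis zero_neq_one)
qed

text \<open>Up to the factor \<open>c\<close>, the nucleus of a line pair is the cross product of
  \<open>l\<close> and \<open>m\<close>, which lies on both lines and hence on the conic.\<close>

lemma half_discriminant_scaled_line_product:
  fixes l m :: "'b::field^3"
  assumes two: "(2::'b) = 0"
  shows "half_discriminant (mat_scale c (line_product l m)) = 0"
  by (simp add: half_discriminant_def line_product_def power2_eq_square algebra_simps char2_simps[OF two])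

text \<open>The off-diagonal coefficients are \<open>c\<close> times the components of the cross
  product of \<open>l\<close> and \<open>m\<close>, which vanishes only for proportional
  vectors.\<close>

lemma distinct_lines_off_diagonal:
  fixes l m :: "'b::field^3"
  assumes two: "(2::'b) = 0" and "distinct_lines l m" "c \<noteq> 0"
  shows "\<not> off_diagonal_zero (mat_scale c (line_product l m))"
proof
  assume "off_diagonal_zero (mat_scale c (line_product l m))"
  then have "l$0 * m$1 + l$1 * m$0 = 0" "l$0 * m$2 + l$2 * m$0 = 0" "l$1 * m$2 + l$2 * m$1 = 0"
    using assms(3) by (simp_all add: off_diagonal_zero_def line_product_def)
  then have cross: "l$0 * m$1 = l$1 * m$0" "l$0 * m$2 = l$2 * m$0" "l$1 * m$2 = l$2 * m$1"
    by (simp_all add: add_eq_0_iff2 char2_simps(3)[OF two])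
  have "l \<noteq> 0"
    using assms(2) by (simp add: distinct_lines_def)
  then consider "l$0 \<noteq> 0" | "l$1 \<noteq> 0" | "l$2 \<noteq> 0"
    by (auto simp: vec_eq_iff all_3)
  then have "\<exists>k. m = k *s l"
  proof cases
    case 1
    then show ?thesis
      using cross by (intro exI[of _ "m$0 / l$0"]) (auto simp: vec_eq_iff all_3 field_simps)
  next
    case 2
    then show ?thesis
      using cross by (intro exI[of _ "m$1 / l$1"]) (auto simp: vec_eq_iff all_3 field_simps)
  next
    case 3
    then show ?thesis
      using cross by (intro exI[of _ "m$2 / l$2"]) (auto simp: vec_eq_iff all_3 field_simps)
  qed
  then show False
    using assms(2) by (auto simp: distinct_lines_def)
qed

lemma half_discriminant_ac_mat: "half_discriminant (ac_mat a) = to_ac (half_discriminant a)"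
  by (simp add: half_discriminant_def ac_mat_def)

lemma off_diagonal_zero_ac_mat: "off_diagonal_zero (ac_mat a) \<longleftrightarrow> off_diagonal_zero a"
  by (simp add: off_diagonal_zero_def ac_mat_def)

lemma nonsingular_conic_half_discriminant:
  fixes a :: "'a::field^3^3"
  assumes two: "(2::'a) = 0" and a: "half_discriminant a \<noteq> 0"
  shows "nonsingular_conic a"
  unfolding nonsingular_conic_def
proof
  have two': "(2::'a alg_closure) = 0"
    using two by (metis to_ac_0 to_ac_numeral)
  note ch = char2_simps[OF two']
  let ?b = "ac_mat a"
  assume "\<exists>x. x \<noteq> 0 \<and> qf_eval ?b x = 0 \<and> (\<forall>k. qf_partial ?b k x = 0)"
  then obtain x where x: "x \<noteq> 0" "qf_eval ?b x = 0" "\<forall>k. qf_partial ?b k x = 0"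
    by blast
  define p q r where pqr: "p = ?b$1$2" "q = ?b$0$2" "r = ?b$0$1"
  have "r * x$1 + q * x$2 = 0" "r * x$0 + p * x$2 = 0" "q * x$0 + p * x$1 = 0"
    using x(3) by (simp_all add: all_3 qf_partial_3 ch pqr)
  then have c: "r * x$1 = q * x$2" "r * x$0 = p * x$2" "q * x$0 = p * x$1"
    by (simp_all add: add_eq_0_iff2 ch(3))
  \<comment> \<open>\<open>x\<close> is proportional to the nucleus \<open>(p, q, r)\<close>.\<close>
  have "t^2 * qf_eval ?b x = s^2 * half_discriminant ?b"
    if t: "t * x$0 = p * s" "t * x$1 = q * s" "t * x$2 = r * s" for t s
  proof -
    have "t^2 * qf_eval ?b x = ?b$0$0 * (t * x$0)^2 + r * (t * x$0) * (t * x$1) + q * (t * x$0) * (t * x$2)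
        + ?b$1$1 * (t * x$1)^2 + p * (t * x$1) * (t * x$2) + ?b$2$2 * (t * x$2)^2"
      by (simp add: qf_eval_3 pqr power2_eq_square algebra_simps)
    also have "\<dots> = s^2 * half_discriminant ?b"
      unfolding t by (simp add: half_discriminant_def pqr power2_eq_square algebra_simps ch)
    finally show ?thesis .
  qed
  \<comment> \<open>Taking \<open>t\<close> from the nucleus and \<open>s\<close> as the matching
    coordinate of \<open>x\<close> expresses the proportionality without division.\<close>
  from this[of p "x$0"] this[of q "x$1"] this[of r "x$2"]
  have "(x$0)^2 * half_discriminant ?b = p^2 * qf_eval ?b x"
    "(x$1)^2 * half_discriminant ?b = q^2 * qf_eval ?b x"
    "(x$2)^2 * half_discriminant ?b = r^2 * qf_eval ?b x"
    by (simp_all add: c)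
  then have "x$0 = 0" "x$1 = 0" "x$2 = 0"
    using x(2) a by (auto simp: half_discriminant_ac_mat)
  then show False
    using x(1) by (auto simp: vec_eq_iff all_3)
qed

lemma off_diagonal_zero_singular:
  fixes a :: "'a::{field,finite}^3^3"
  assumes two: "(2::'a) = 0" and a: "off_diagonal_zero a"
  shows "\<not> nonsingular_conic a"
proof -
  have two': "(2::'a alg_closure) = 0"
    using two by (metis to_ac_0 to_ac_numeral)
  obtain f where f: "\<And>x::'a. x = (f x)^2"
    using ex_square_root_char2[OF two] by metis
  let ?d = "\<lambda>i. to_ac (f (a$i$i))"
  have d: "to_ac (a$i$i) = ?d i * ?d i" for i
    using arg_cong[OF f[of "a$i$i"], of to_ac] by (simp add: power2_eq_square)
  \<comment> \<open>A point on the line whose square is the form. The second choice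
    \<open>(?d 1, ?d 0, 0)\<close> is nonzero since it is made only for \<open>?d 0\<close> nonzero.
    All partial derivatives of the square vanish identically.\<close>
  define x :: "'a alg_closure^3" where "x =
    (if ?d 0 = 0 then (\<chi> i. if i = 0 then 1 else 0) else (\<chi> i. if i = 0 then ?d 1 else if i = 1 then ?d 0 else 0))"
  have "x \<noteq> 0"
    by (auto simp: x_def vec_eq_iff all_3)
  moreover have "qf_eval (ac_mat a) x = 0"
    using a by (simp add: qf_eval_3 x_def ac_mat_def off_diagonal_zero_def d algebra_simps char2_simps[OF two'])
  moreover have "qf_partial (ac_mat a) k x = 0" for k
  proof -
    have "\<forall>k. qf_partial (ac_mat a) k x = 0"
      using a by (simp add: all_3 qf_partial_3 ac_mat_def off_diagonal_zero_def char2_simps[OF two'])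
    then show ?thesis ..
  qed
  ultimately show ?thesis
    unfolding nonsingular_conic_def by blast
qed

text \<open>The q^3 forms vanishing on \<open>W\<close> split by their nucleus. Nucleus zero leaves
  the multiples of one double line; the other q^3 - q forms have nonzero half-discriminant, so they
  are non-singular conics and not line pairs, and they give (q^3 - q) / (q - 1) = q^2 + q
  hyperplanes.\<close>

lemma hyperplane_distribution_only_singular_point:
  fixes W :: "('a::{field,finite}^3^3) set"
  assumes two: "(2::'a) = 0" and W: "W \<in> pg5_subspaces 2" and M: "only_singular_point M W"
  shows "hyperplane_orbit_distribution W = (1, 0, 0, CARD('a)^2 + CARD('a))"
proof -
  have two': "(2::'a alg_closure) = 0"
    using two by (metis to_ac_0 to_ac_numeral)
  have sub: "W \<subseteq> sym_mats"
    using W by (simp add: pg5_subspaces_def)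
  have Q: "nucleus_line M \<noteq> 0"
    using M nucleus_line_nonzero by (auto simp: only_singular_point_def)
  have upper: "a \<in> upper_mats" if "a \<in> annihilator W" for a
    using that by (simp add: annihilator_def)
  have type: "{H \<in> hyperplanes_of_type T. W \<subseteq> H} = hyperplane_of ` {a \<in> annihilator W - {0}. T a}" for T
    using subset_hyperplane_of_iff[OF sub] upper
    by (fastforce simp: hyperplanes_of_type_def quadratic_forms_eq)
  note diag = annihilator_diagonal_iff[OF two W M]
  have nonzero: "half_discriminant a \<noteq> 0" if "a \<in> annihilator W" "\<not> off_diagonal_zero a" for a
    using annihilator_half_discriminant[OF two W M that] .
  have "{a \<in> annihilator W - {0}. double_line a} = {a \<in> mats.span {nucleus_line M}. a \<noteq> 0}"
    using double_line_iff[OF two] upper diag by blast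
  also have "hyperplane_of ` \<dots> = {hyperplane_of (nucleus_line M)}"
  proof -
    have "nucleus_line M \<in> {a \<in> mats.span {nucleus_line M}. a \<noteq> 0}"
      using Q by (simp add: mats.span_base)
    moreover have "hyperplane_of a = hyperplane_of (nucleus_line M)"
      if a: "a \<in> mats.span {nucleus_line M}" "a \<noteq> 0" for a
    proof -
      obtain k where k: "a = mat_scale k (nucleus_line M)"
        using a(1) by (auto simp: mats.span_singleton)
      then have "k \<noteq> 0"
        using a(2) by auto
      then show ?thesis
        by (auto simp: k hyperplane_of_eq pairing_scale)
    qed
    ultimately show ?thesis
      by blast
  qed
  finally have h1: "card {H \<in> hyperplanes_of_type double_line. W \<subseteq> H} = 1"
    unfolding type by simp
  have "\<not> real_line_pair a" if "a \<in> annihilator W" for a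
    using nonzero[OF that] distinct_lines_off_diagonal[OF two] half_discriminant_scaled_line_product[OF two]
    unfolding real_line_pair_def by metis
  then have h2: "{H \<in> hyperplanes_of_type real_line_pair. W \<subseteq> H} = {}"
    unfolding type by blast
  have "\<not> imaginary_line_pair a" if a: "a \<in> annihilator W" for a
  proof
    assume "imaginary_line_pair a"
    then obtain c l where l: "c \<noteq> 0" "distinct_lines l (conj_line l)"
      "ac_mat a = mat_scale (to_ac c) (line_product l (conj_line l))"
      unfolding imaginary_line_pair_def by blast
    \<comment> \<open>The facts about line pairs hold over any field of characteristic 2, here the
      algebraic closure, and both quantities are compatible with the embedding.\<close>
    have "half_discriminant (ac_mat a) = 0" "\<not> off_diagonal_zero (ac_mat a)"
      unfolding l(3) using l(1,2) distinct_lines_off_diagonal[OF two'] half_discriminant_scaled_line_product[OF two']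
      by simp_all
    then show False
      using nonzero[OF a] by (simp add: half_discriminant_ac_mat off_diagonal_zero_ac_mat)
  qed
  then have h3: "{H \<in> hyperplanes_of_type imaginary_line_pair. W \<subseteq> H} = {}"
    unfolding type by blast
  let ?A = "annihilator W - mats.span {nucleus_line M}"
  have "{a \<in> annihilator W - {0}. nonsingular_conic a} = ?A"
    using nonsingular_conic_half_discriminant[OF two nonzero] off_diagonal_zero_singular[OF two] diag
      mats.span_zero by blast
  then have c1: "card {H \<in> hyperplanes_of_type nonsingular_conic. W \<subseteq> H} = card (hyperplane_of ` ?A)"
    unfolding type by simp
  have c2: "card ?A = (CARD('a) - 1) * card (hyperplane_of ` ?A)"
  proof (rule card_eq_mult_card_projective_image)
    show "mat_scale k a \<in> ?A" if "a \<in> ?A" "k \<noteq> 0" for a k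
    proof -
      have "a \<in> mats.span {nucleus_line M}" if "mat_scale k a \<in> mats.span {nucleus_line M}"
        using mats.span_scale[OF that, of "1 / k"] \<open>k \<noteq> 0\<close> by simp
      then show ?thesis
        using that mats.subspace_scale[OF subspace_annihilator] by auto
    qed
    show "0 \<notin> ?A"
      by (simp add: mats.span_zero)
    show "hyperplane_of a = hyperplane_of b \<longleftrightarrow> (\<exists>k. k \<noteq> 0 \<and> b = mat_scale k a)"
      if "a \<in> ?A" "b \<in> ?A" for a b
      using that upper mats.span_zero by (intro hyperplane_of_eq_iff) auto
  qed
  have c3: "card ?A = CARD('a)^3 - CARD('a)"
  proof -
    have "mats.span {nucleus_line M} \<subseteq> annihilator W"
      using diag by blast
    then show ?thesis
      using card_annihilator[OF two W M] card_span_singleton[OF Q] by (simp add: card_Diff_subset)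
  qed
  have c4: "CARD('a)^3 - CARD('a) = (CARD('a) - 1) * (CARD('a)^2 + CARD('a))"
    using card_field_gt_1[where 'a = 'a]
    by (cases "CARD('a)") (simp_all add: algebra_simps power2_eq_square power3_eq_cube)
  have "(CARD('a) - 1) * card {H \<in> hyperplanes_of_type nonsingular_conic. W \<subseteq> H}
      = (CARD('a) - 1) * (CARD('a)^2 + CARD('a))"
    unfolding c1 c2[symmetric] c3 c4 ..
  then have "card {H \<in> hyperplanes_of_type nonsingular_conic. W \<subseteq> H} = CARD('a)^2 + CARD('a)"
    using card_field_gt_1[where 'a = 'a] unfolding mult_cancel1 by simp
  then show ?thesis
    using h1 h2 h3 by (simp add: hyperplane_orbit_distribution_def)
qed

section \<open>The orbit and its two distributions\<close>

theorem theorem3p9: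
  fixes q :: nat
  assumes "q = CARD('a::{field,finite})" and "even q" and "q \<ge> 4"
  shows "\<exists>Sigma18 \<in> (plane_orbits :: ('a^3^3) set set set).
           {W \<in> pg5_subspaces 2. point_orbit_distribution W = (0, 1, 0, q\<^sup>2 + q)} = Sigma18 \<and>
           (\<forall>W \<in> Sigma18. hyperplane_orbit_distribution W = (1, 0, 0, q\<^sup>2 + q))"
proof -
  have two: "(2::'a) = 0"
    using assms even_card_imp_char2 by blast
  \<comment> \<open>A monic anisotropic cubic supplies the representative of the orbit, so such
    planes exist.\<close>
  obtain \<alpha> \<delta> \<beta> :: 'a where an: "anisotropic 1 \<alpha> \<delta> \<beta>"
    using ex_anisotropic_cubic by blast
  let ?W = "normal_plane \<alpha> \<beta> 1 \<delta>"
  let ?S = "{W \<in> pg5_subspaces 2. \<exists>M. only_singular_point M W} :: ('a^3^3) set set"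
  have S: "{W \<in> pg5_subspaces 2. point_orbit_distribution W = (0, 1, 0, q\<^sup>2 + q)} = ?S"
    using point_orbit_distribution_iff[OF two] assms(1) by auto
  have "?S = K_orbit ?W"
  proof (intro equalityI subsetI)
    fix W assume "W \<in> ?S"
    then obtain M where W: "W \<in> pg5_subspaces 2" "only_singular_point M W"
      by blast
    obtain A \<alpha>' \<beta>' \<gamma>' \<delta>' where A: "invertible A" "anisotropic \<gamma>' \<alpha>' \<delta>' \<beta>'"
      "K_map A W = normal_plane \<alpha>' \<beta>' \<gamma>' \<delta>'"
      using K_map_to_normal_plane[OF two W] by blast
    obtain B where B: "invertible B" "K_map B ?W = normal_plane \<alpha>' \<beta>' \<gamma>' \<delta>'"
      using normal_planes_equivalent[OF two an A(2)] by blast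
    obtain C where C: "invertible C" "\<forall>U. K_map C (K_map A U) = U"
      using ex_K_map_inverse[OF A(1)] by blast
    \<comment> \<open>\<open>A\<close> and \<open>B\<close> bring \<open>W\<close> and the
      representative to the same normal plane, and \<open>C\<close> undoes \<open>A\<close>.\<close>
    have "W = K_map (C ** B) ?W"
      using C(2) A(3) B(2) by (metis K_map_compose)
    then show "W \<in> K_orbit ?W"
      using invertible_mult[OF C(1) B(1)] by (auto simp: K_orbit_eq)
  next
    fix W assume "W \<in> K_orbit ?W"
    then obtain A where "invertible A" "W = K_map A ?W"
      by (auto simp: K_orbit_eq)
    then show "W \<in> ?S"
      using K_map_pg5_subspaces normal_plane_pg5_subspaces
        K_map_only_singular_point[OF two] normal_plane_only_singular_point[OF two an] by blast
  qed
  moreover have "K_orbit ?W \<in> plane_orbits"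
    using normal_plane_pg5_subspaces unfolding plane_orbits_def by blast
  moreover have "hyperplane_orbit_distribution W = (1, 0, 0, q\<^sup>2 + q)" if "W \<in> ?S" for W
    using that hyperplane_distribution_only_singular_point[OF two] assms(1) by blast
  ultimately show ?thesis
    unfolding S by (intro bexI[of _ "K_orbit ?W"]) auto
qed

end
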